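(* Let $\mathcal{L}$ be a tame fragment of $\mathrm{SOL}$ such that the rich disjoint union $\sqcup_{rich}$ is $\mathcal{L}$-smooth, and let $\Box$ be an $\mathcal{L}$-sum-like binary operation on $\tau$-structures. Let $P$ be an $\mathcal{L}(\tau)$-polynomial. Then the connection matrix $M(\Box,P)$ has finite rank.
   Context: $\tau$ is a finite relational vocabulary (possibly with constant symbols). A subset $\mathcal{L}$ of second-order logic $\mathrm{SOL}$ is a fragment if: for each such $\tau$, $\mathcal{L}(\tau)$ contains the atomic $\tau$-formulas and is closed under $\wedge,\vee,\neg$ and renaming of relation and constant symbols; there is a quantifier rank $qr:\mathcal{L}\to\mathbb{N}$, $0$ on atomic formulas, equal to the maximum on Boolean combinations, and sub-additive under substitution; for each $q$ and fixed set of free variables there are only finitely many formulas of quantifier rank $\le q$ up to logical equivalence; and for $\phi(x)\in\mathcal{L}$, $\exists x\phi(x)$ is equivalent to a formula of $\mathcal{L}$. A scalar $\mathcal{L}$-transduction $\Phi$ from $\tau$- to $\sigma$-structures consists of $\mathcal{L}(\tau)$-formulas $\phi_{univ}(x)$ and, for each $k$-ary $R\in\sigma$, $\phi_R(x_1,\dots,x_k)$; $\Phi^\star(\mathfrak{A})$ is the $\sigma$-structure with universe $\{a:\mathfrak{A}\models\phi_{univ}(a)\}$ and $R$ interpreted by $\phi_R$; $\Phi^\sharp(\theta)$ is the induced backward translation of a $\sigma$-formula $\theta$ into a $\tau$-formula with $\Phi^\star(\mathfrak{A})\models\theta$ iff $\mathfrak{A}\models\Phi^\sharp(\theta)$. $\mathcal{L}$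 is tame if $\Phi^\sharp(\theta)\in\mathcal{L}(\tau)$ whenever $\Phi$ is a scalar transduction with formulas in $\mathcal{L}(\tau)$ and $\theta\in\mathcal{L}(\sigma)$, and $\mathcal{L}$ is closed under forming $\forall x(\varphi(x)\to\psi(x))$. Write $\mathfrak{A}\equiv_q\mathfrak{B}$ if $\mathfrak{A},\mathfrak{B}$ satisfy the same $\mathcal{L}$-sentences of quantifier rank $\le q$; an operation $\Box$ is $\mathcal{L}$-smooth if $\mathfrak{A}_1\equiv_q\mathfrak{B}_1$ and $\mathfrak{A}_2\equiv_q\mathfrak{B}_2$ imply $\mathfrak{A}_1\Box\mathfrak{A}_2\equiv_q\mathfrak{B}_1\Box\mathfrak{B}_2$ for all $q$. The rich disjoint union $\mathfrak{A}\sqcup_{rich}\mathfrak{B}$ is the disjoint union expanded by two unary predicates for $A$ and $B$. $\Box$ is $\mathcal{L}$-sum-like if there is a scalar $\mathcal{L}$-transduction $\Phi$ with $\mathfrak{A}\Box\mathfrak{B}=\Phi^\star(\mathfrak{A}\sqcup_{rich}\mathfrak{B})$ for all $\mathfrak{A},\mathfrak{B}$. $\mathcal{L}(\tau)$-polynomials, over a fixed finite set $\mathbf{X}$ of indeterminates, are defined inductively for a $\tau$-structure $\mathcal{M}$: simple monomials are elements of $\mathbb{N}\cup\mathbf{X}$; monomials are simple monomials, expressions $\prod_{a:\langle\mathcal{M},a\rangle\models\phi(a)}t$ with $\phi\in\mathcal{L}(\tau\cup\{a\})$, $a$ a new constant and $t$ a simple monomial, and finite products of monomials; polynomials are monomials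 and expressions $\sum_{\bar a:\langle\mathcal{M},\bar a\rangle\models\phi(\bar a)}t$ and $\sum_{\bar R:\langle\mathcal{M},\bar R\rangle\models\phi(\bar R)}t$ where $\bar a$ are new constants, $\bar R$ new relation symbols, $\phi$ an $\mathcal{L}$-formula over the expanded vocabulary and $t$ an $\mathcal{L}$-polynomial over the expanded vocabulary. The connection matrix $M(\Box,P)$ has rows and columns indexed by the finite $\tau$-structures and entry $P(\mathfrak{A}\Box\mathfrak{B})$ at $(\mathfrak{A},\mathfrak{B})$; its rank is taken over the field of rational functions in the indeterminates $\mathbf{X}$.
   Formalization: In L-polynomials, sums over new relation symbols are restricted to arity at most 1; for binary symbols the claim fails, since summing 1 over all linear orders gives |A|!, whose connection matrix ((i+j)!) under disjoint union has infinite rank. *)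

theory Defs
  imports
    "HOL-Library.Poly_Mapping"
    "HOL-Library.Function_Algebras"
    "HOL-Library.Nat_Bijection"
    "HOL-Library.Extended_Nat"
    "HOL-Computational_Algebra.Fraction_Field"
begin

section \<open>Second-order logic over finite structures\<close>

text \<open>
  \<open>RSym n k\<close> is the \<open>n\<close>-th relation symbol of arity \<open>k\<close>. The remaining constructors provide the
  symbols of the vocabulary of a rich disjoint union: a tagged copy of every relation symbol, two
  new unary predicates for the two parts, and two copies of every constant symbol. As fragments
  are closed under renaming, the tags only serve to make the new symbols distinct from the old ones.
\<close>

datatype rsym = RSym nat nat | RIn rsym | PLeft | PRight

datatype csym = CSym nat | CLeft csym | CRight csym

primrec arity :: "rsym \<Rightarrow> nat" where
  "arity (RSym n k) = k"
| "arity (RIn R) = arity R"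
| "arity PLeft = 1"
| "arity PRight = 1"

record vocab =
  rels :: "rsym set"
  csts :: "csym set"

definition vocabulary :: "vocab \<Rightarrow> bool" where
  "vocabulary \<tau> \<longleftrightarrow> finite (rels \<tau>) \<and> finite (csts \<tau>)"

text \<open>A relation variable is a pair of a name and an arity.\<close>

type_synonym rvar = "nat \<times> nat"

datatype tm = Var nat | Const csym

datatype form =
    Eq tm tm
  | Rel rsym "tm list"
  | RVar rvar "tm list"
  | Neg form
  | Conj form form
  | Disj form form
  | Ex nat form
  | All nat form
  | Ex2 rvar form
  | All2 rvar form

abbreviation Imp :: "form \<Rightarrow> form \<Rightarrow> form" where
  "Imp \<phi> \<psi> \<equiv> Disj (Neg \<phi>) \<psi>"

fun atomic :: "form \<Rightarrow> bool" where
  "atomic (Eq t u) = True"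
| "atomic (Rel R ts) = True"
| "atomic (RVar X ts) = True"
| "atomic _ = False"

primrec tm_vars :: "tm \<Rightarrow> nat set" where
  "tm_vars (Var x) = {x}"
| "tm_vars (Const c) = {}"

primrec tm_over :: "vocab \<Rightarrow> tm \<Rightarrow> bool" where
  "tm_over \<tau> (Var x) = True"
| "tm_over \<tau> (Const c) = (c \<in> csts \<tau>)"

text \<open>Free first-order variables and free relation variables.\<close>

primrec fv :: "form \<Rightarrow> nat set" where
  "fv (Eq t u) = tm_vars t \<union> tm_vars u"
| "fv (Rel R ts) = (\<Union>t\<in>set ts. tm_vars t)"
| "fv (RVar X ts) = (\<Union>t\<in>set ts. tm_vars t)"
| "fv (Neg \<phi>) = fv \<phi>"
| "fv (Conj \<phi> \<psi>) = fv \<phi> \<union> fv \<psi>"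
| "fv (Disj \<phi> \<psi>) = fv \<phi> \<union> fv \<psi>"
| "fv (Ex x \<phi>) = fv \<phi> - {x}"
| "fv (All x \<phi>) = fv \<phi> - {x}"
| "fv (Ex2 X \<phi>) = fv \<phi>"
| "fv (All2 X \<phi>) = fv \<phi>"

primrec frv :: "form \<Rightarrow> rvar set" where
  "frv (Eq t u) = {}"
| "frv (Rel R ts) = {}"
| "frv (RVar X ts) = {X}"
| "frv (Neg \<phi>) = frv \<phi>"
| "frv (Conj \<phi> \<psi>) = frv \<phi> \<union> frv \<psi>"
| "frv (Disj \<phi> \<psi>) = frv \<phi> \<union> frv \<psi>"
| "frv (Ex x \<phi>) = frv \<phi>"
| "frv (All x \<phi>) = frv \<phi>"
| "frv (Ex2 X \<phi>) = frv \<phi> - {X}"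
| "frv (All2 X \<phi>) = frv \<phi> - {X}"

primrec over :: "vocab \<Rightarrow> form \<Rightarrow> bool" where
  "over \<tau> (Eq t u) = (tm_over \<tau> t \<and> tm_over \<tau> u)"
| "over \<tau> (Rel R ts) = (R \<in> rels \<tau> \<and> length ts = arity R \<and> (\<forall>t\<in>set ts. tm_over \<tau> t))"
| "over \<tau> (RVar X ts) = (length ts = snd X \<and> (\<forall>t\<in>set ts. tm_over \<tau> t))"
| "over \<tau> (Neg \<phi>) = over \<tau> \<phi>"
| "over \<tau> (Conj \<phi> \<psi>) = (over \<tau> \<phi> \<and> over \<tau> \<psi>)"
| "over \<tau> (Disj \<phi> \<psi>) = (over \<tau> \<phi> \<and> over \<tau> \<psi>)"
| "over \<tau> (Ex x \<phi>) = over \<tau> \<phi>"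
| "over \<tau> (All x \<phi>) = over \<tau> \<phi>"
| "over \<tau> (Ex2 X \<phi>) = over \<tau> \<phi>"
| "over \<tau> (All2 X \<phi>) = over \<tau> \<phi>"

text \<open>
  Structures are finite with a nonempty universe of natural numbers, so every finite structure is
  isomorphic to one of them. Values at symbols outside the vocabulary are irrelevant.
\<close>

record struct =
  univ :: "nat set"
  rel :: "rsym \<Rightarrow> nat list set"
  cst :: "csym \<Rightarrow> nat"

definition tuples :: "nat set \<Rightarrow> nat \<Rightarrow> nat list set" where
  "tuples U k = {as. length as = k \<and> set as \<subseteq> U}"

definition Str :: "vocab \<Rightarrow> struct set" where
  "Str \<tau> = {A. finite (univ A) \<and> univ A \<noteq> {} \<and>
              (\<forall>R\<in>rels \<tau>. rel A R \<subseteq> tuples (univ A) (arity R)) \<and>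
              (\<forall>c\<in>csts \<tau>. cst A c \<in> univ A)}"

definition isomorphic :: "vocab \<Rightarrow> struct \<Rightarrow> struct \<Rightarrow> bool" where
  "isomorphic \<tau> A B \<longleftrightarrow>
     (\<exists>f. bij_betw f (univ A) (univ B) \<and>
          (\<forall>R\<in>rels \<tau>. \<forall>as\<in>tuples (univ A) (arity R). as \<in> rel A R \<longleftrightarrow> map f as \<in> rel B R) \<and>
          (\<forall>c\<in>csts \<tau>. f (cst A c) = cst B c))"

primrec tval :: "struct \<Rightarrow> (nat \<Rightarrow> nat) \<Rightarrow> tm \<Rightarrow> nat" where
  "tval A s (Var x) = s x"
| "tval A s (Const c) = cst A c"

primrec sat :: "struct \<Rightarrow> (nat \<Rightarrow> nat) \<Rightarrow> (rvar \<Rightarrow> nat list set) \<Rightarrow> form \<Rightarrow> bool" where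
  "sat A s e (Eq t u) = (tval A s t = tval A s u)"
| "sat A s e (Rel R ts) = (map (tval A s) ts \<in> rel A R)"
| "sat A s e (RVar X ts) = (map (tval A s) ts \<in> e X)"
| "sat A s e (Neg \<phi>) = (\<not> sat A s e \<phi>)"
| "sat A s e (Conj \<phi> \<psi>) = (sat A s e \<phi> \<and> sat A s e \<psi>)"
| "sat A s e (Disj \<phi> \<psi>) = (sat A s e \<phi> \<or> sat A s e \<psi>)"
| "sat A s e (Ex x \<phi>) = (\<exists>a\<in>univ A. sat A (s(x := a)) e \<phi>)"
| "sat A s e (All x \<phi>) = (\<forall>a\<in>univ A. sat A (s(x := a)) e \<phi>)"
| "sat A s e (Ex2 X \<phi>) = (\<exists>V\<subseteq>tuples (univ A) (snd X). sat A s (e(X := V)) \<phi>)"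
| "sat A s e (All2 X \<phi>) = (\<forall>V\<subseteq>tuples (univ A) (snd X). sat A s (e(X := V)) \<phi>)"

text \<open>
  \<open>holds A \<phi> as\<close> is the truth of a formula without free relation variables whose free variables
  are among \<open>0, \<dots>, length as - 1\<close>, where variable \<open>i\<close> denotes the \<open>i\<close>-th entry of \<open>as\<close>.
\<close>

definition holds :: "struct \<Rightarrow> form \<Rightarrow> nat list \<Rightarrow> bool" where
  "holds A \<phi> as = sat A (nth as) (\<lambda>_. {}) \<phi>"

abbreviation models :: "struct \<Rightarrow> form \<Rightarrow> bool" where
  "models A \<phi> \<equiv> holds A \<phi> []"

definition equivalent :: "vocab \<Rightarrow> form \<Rightarrow> form \<Rightarrow> bool" where
  "equivalent \<tau> \<phi> \<psi> \<longleftrightarrow>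
     (\<forall>A\<in>Str \<tau>. \<forall>s e. range s \<subseteq> univ A \<longrightarrow> (\<forall>X. e X \<subseteq> tuples (univ A) (snd X)) \<longrightarrow>
        sat A s e \<phi> = sat A s e \<psi>)"


section \<open>Renaming and substitution\<close>

primrec rename_tm :: "(csym \<Rightarrow> csym) \<Rightarrow> tm \<Rightarrow> tm" where
  "rename_tm \<kappa> (Var x) = Var x"
| "rename_tm \<kappa> (Const c) = Const (\<kappa> c)"

primrec rename :: "(rsym \<Rightarrow> rsym) \<Rightarrow> (csym \<Rightarrow> csym) \<Rightarrow> form \<Rightarrow> form" where
  "rename \<rho> \<kappa> (Eq t u) = Eq (rename_tm \<kappa> t) (rename_tm \<kappa> u)"
| "rename \<rho> \<kappa> (Rel R ts) = Rel (\<rho> R) (map (rename_tm \<kappa>) ts)"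
| "rename \<rho> \<kappa> (RVar X ts) = RVar X (map (rename_tm \<kappa>) ts)"
| "rename \<rho> \<kappa> (Neg \<phi>) = Neg (rename \<rho> \<kappa> \<phi>)"
| "rename \<rho> \<kappa> (Conj \<phi> \<psi>) = Conj (rename \<rho> \<kappa> \<phi>) (rename \<rho> \<kappa> \<psi>)"
| "rename \<rho> \<kappa> (Disj \<phi> \<psi>) = Disj (rename \<rho> \<kappa> \<phi>) (rename \<rho> \<kappa> \<psi>)"
| "rename \<rho> \<kappa> (Ex x \<phi>) = Ex x (rename \<rho> \<kappa> \<phi>)"
| "rename \<rho> \<kappa> (All x \<phi>) = All x (rename \<rho> \<kappa> \<phi>)"
| "rename \<rho> \<kappa> (Ex2 X \<phi>) = Ex2 X (rename \<rho> \<kappa> \<phi>)"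
| "rename \<rho> \<kappa> (All2 X \<phi>) = All2 X (rename \<rho> \<kappa> \<phi>)"

definition fresh :: "(nat \<Rightarrow> tm) \<Rightarrow> nat set \<Rightarrow> nat" where
  "fresh s V = (LEAST y. y \<notin> (\<Union>x\<in>V. tm_vars (s x)))"

text \<open>Capture-avoiding substitution of terms for first-order variables.\<close>

primrec tm_subst :: "(nat \<Rightarrow> tm) \<Rightarrow> tm \<Rightarrow> tm" where
  "tm_subst s (Var x) = s x"
| "tm_subst s (Const c) = Const c"

primrec subst :: "(nat \<Rightarrow> tm) \<Rightarrow> form \<Rightarrow> form" where
  "subst s (Eq t u) = Eq (tm_subst s t) (tm_subst s u)"
| "subst s (Rel R ts) = Rel R (map (tm_subst s) ts)"
| "subst s (RVar X ts) = RVar X (map (tm_subst s) ts)"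
| "subst s (Neg \<phi>) = Neg (subst s \<phi>)"
| "subst s (Conj \<phi> \<psi>) = Conj (subst s \<phi>) (subst s \<psi>)"
| "subst s (Disj \<phi> \<psi>) = Disj (subst s \<phi>) (subst s \<psi>)"
| "subst s (Ex x \<phi>) =
     (let y = fresh s (fv \<phi> - {x}) in Ex y (subst (s(x := Var y)) \<phi>))"
| "subst s (All x \<phi>) =
     (let y = fresh s (fv \<phi> - {x}) in All y (subst (s(x := Var y)) \<phi>))"
| "subst s (Ex2 X \<phi>) = Ex2 X (subst s \<phi>)"
| "subst s (All2 X \<phi>) = All2 X (subst s \<phi>)"

text \<open>\<open>inst \<phi> ts\<close> is \<open>\<phi>(t\<^sub>0, \<dots>, t\<^sub>k\<^sub>-\<^sub>1)\<close>, for \<open>\<phi>\<close> with free variables among \<open>0, \<dots>, k - 1\<close>.\<close>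

definition inst :: "form \<Rightarrow> tm list \<Rightarrow> form" where
  "inst \<phi> ts = subst (\<lambda>i. if i < length ts then ts ! i else Var i) \<phi>"

text \<open>
  Substitution of \<open>S R\<close>, a formula with parameters \<open>0, \<dots>, arity R - 1\<close> and no other free variables,
  for each relation symbol \<open>R\<close>.
\<close>

primrec rel_subst :: "(rsym \<Rightarrow> form) \<Rightarrow> form \<Rightarrow> form" where
  "rel_subst S (Eq t u) = Eq t u"
| "rel_subst S (Rel R ts) = inst (S R) ts"
| "rel_subst S (RVar X ts) = RVar X ts"
| "rel_subst S (Neg \<phi>) = Neg (rel_subst S \<phi>)"
| "rel_subst S (Conj \<phi> \<psi>) = Conj (rel_subst S \<phi>) (rel_subst S \<psi>)"
| "rel_subst S (Disj \<phi> \<psi>) = Disj (rel_subst S \<phi>) (rel_subst S \<psi>)"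
| "rel_subst S (Ex x \<phi>) = Ex x (rel_subst S \<phi>)"
| "rel_subst S (All x \<phi>) = All x (rel_subst S \<phi>)"
| "rel_subst S (Ex2 X \<phi>) = Ex2 X (rel_subst S \<phi>)"
| "rel_subst S (All2 X \<phi>) = All2 X (rel_subst S \<phi>)"


section \<open>Fragments of second-order logic\<close>

definition Lang :: "form set \<Rightarrow> vocab \<Rightarrow> form set" where
  "Lang L \<tau> = {\<phi>\<in>L. over \<tau> \<phi>}"

definition param_form :: "form set \<Rightarrow> vocab \<Rightarrow> nat \<Rightarrow> form \<Rightarrow> bool" where
  "param_form L \<tau> k \<phi> \<longleftrightarrow> \<phi> \<in> Lang L \<tau> \<and> fv \<phi> \<subseteq> {..<k} \<and> frv \<phi> = {}"

abbreviation sentence :: "form set \<Rightarrow> vocab \<Rightarrow> form \<Rightarrow> bool" where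
  "sentence L \<tau> \<phi> \<equiv> param_form L \<tau> 0 \<phi>"

locale fragment =
  fixes L :: "form set" and qr :: "form \<Rightarrow> nat"
  assumes Eq_closed: "vocabulary \<tau> \<Longrightarrow> over \<tau> (Eq t u) \<Longrightarrow> Eq t u \<in> L"
    and Rel_closed: "vocabulary \<tau> \<Longrightarrow> over \<tau> (Rel R ts) \<Longrightarrow> Rel R ts \<in> L"
    and Neg_closed: "vocabulary \<tau> \<Longrightarrow> \<phi> \<in> Lang L \<tau> \<Longrightarrow> Neg \<phi> \<in> L"
    and Conj_closed: "vocabulary \<tau> \<Longrightarrow> \<phi> \<in> Lang L \<tau> \<Longrightarrow> \<psi> \<in> Lang L \<tau> \<Longrightarrow> Conj \<phi> \<psi> \<in> L"
    and Disj_closed: "vocabulary \<tau> \<Longrightarrow> \<phi> \<in> Lang L \<tau> \<Longrightarrow> \<psi> \<in> Lang L \<tau> \<Longrightarrow> Disj \<phi> \<psi> \<in> L"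
    and rename_closed: "vocabulary \<tau> \<Longrightarrow> \<phi> \<in> Lang L \<tau> \<Longrightarrow>
      inj_on \<rho> (rels \<tau>) \<Longrightarrow> (\<forall>R\<in>rels \<tau>. arity (\<rho> R) = arity R) \<Longrightarrow> inj_on \<kappa> (csts \<tau>) \<Longrightarrow>
      rename \<rho> \<kappa> \<phi> \<in> L"
    and qr_atomic: "vocabulary \<tau> \<Longrightarrow> \<phi> \<in> Lang L \<tau> \<Longrightarrow> atomic \<phi> \<Longrightarrow> qr \<phi> = 0"
    and qr_Neg: "vocabulary \<tau> \<Longrightarrow> \<phi> \<in> Lang L \<tau> \<Longrightarrow> qr (Neg \<phi>) = qr \<phi>"
    and qr_Conj: "vocabulary \<tau> \<Longrightarrow> \<phi> \<in> Lang L \<tau> \<Longrightarrow> \<psi> \<in> Lang L \<tau> \<Longrightarrow>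
      qr (Conj \<phi> \<psi>) = max (qr \<phi>) (qr \<psi>)"
    and qr_Disj: "vocabulary \<tau> \<Longrightarrow> \<phi> \<in> Lang L \<tau> \<Longrightarrow> \<psi> \<in> Lang L \<tau> \<Longrightarrow>
      qr (Disj \<phi> \<psi>) = max (qr \<phi>) (qr \<psi>)"
    and qr_rel_subst: "vocabulary \<sigma> \<Longrightarrow> vocabulary \<tau> \<Longrightarrow> csts \<sigma> \<subseteq> csts \<tau> \<Longrightarrow> \<theta> \<in> Lang L \<sigma> \<Longrightarrow>
      (\<forall>R\<in>rels \<sigma>. param_form L \<tau> (arity R) (S R) \<and> qr (S R) \<le> m) \<Longrightarrow>
      rel_subst S \<theta> \<in> Lang L \<tau> \<Longrightarrow> qr (rel_subst S \<theta>) \<le> qr \<theta> + m"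
    and finitely_many: "vocabulary \<tau> \<Longrightarrow> finite V \<Longrightarrow> finite W \<Longrightarrow>
      \<exists>F. finite F \<and>
        (\<forall>\<phi>\<in>Lang L \<tau>. qr \<phi> \<le> q \<and> fv \<phi> = V \<and> frv \<phi> = W \<longrightarrow> (\<exists>\<psi>\<in>F. equivalent \<tau> \<phi> \<psi>))"
    and Ex_equivalent: "vocabulary \<tau> \<Longrightarrow> \<phi> \<in> Lang L \<tau> \<Longrightarrow> \<exists>\<psi>\<in>Lang L \<tau>. equivalent \<tau> (Ex x \<phi>) \<psi>"


section \<open>Scalar transductions\<close>

text \<open>
  Constant symbols of the target vocabulary are interpreted by constant symbols of the source
  vocabulary.
\<close>

record transd =
  t_univ :: form
  t_rel :: "rsym \<Rightarrow> form"
  t_cst :: "csym \<Rightarrow> csym"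

definition transduction :: "form set \<Rightarrow> vocab \<Rightarrow> vocab \<Rightarrow> transd \<Rightarrow> bool" where
  "transduction L \<tau> \<sigma> \<Phi> \<longleftrightarrow>
     param_form L \<tau> 1 (t_univ \<Phi>) \<and>
     (\<forall>R\<in>rels \<sigma>. param_form L \<tau> (arity R) (t_rel \<Phi> R)) \<and>
     (\<forall>c\<in>csts \<sigma>. t_cst \<Phi> c \<in> csts \<tau>)"

definition star :: "transd \<Rightarrow> struct \<Rightarrow> struct" where
  "star \<Phi> A =
     (let U = {a\<in>univ A. holds A (t_univ \<Phi>) [a]} in
      \<lparr>univ = U,
       rel = (\<lambda>R. {as\<in>tuples U (arity R). holds A (t_rel \<Phi> R) as}),
       cst = (\<lambda>c. cst A (t_cst \<Phi> c))\<rparr>)"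

text \<open>
  The backward translation replaces relation symbols by their defining formulas and relativizes
  first-order quantifiers to the new universe. Relation quantifiers need no relativization,
  because a relation variable is only ever applied to elements of the new universe.
\<close>

primrec sharp :: "transd \<Rightarrow> form \<Rightarrow> form" where
  "sharp \<Phi> (Eq t u) = Eq (rename_tm (t_cst \<Phi>) t) (rename_tm (t_cst \<Phi>) u)"
| "sharp \<Phi> (Rel R ts) = inst (t_rel \<Phi> R) (map (rename_tm (t_cst \<Phi>)) ts)"
| "sharp \<Phi> (RVar X ts) = RVar X (map (rename_tm (t_cst \<Phi>)) ts)"
| "sharp \<Phi> (Neg \<phi>) = Neg (sharp \<Phi> \<phi>)"
| "sharp \<Phi> (Conj \<phi> \<psi>) = Conj (sharp \<Phi> \<phi>) (sharp \<Phi> \<psi>)"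
| "sharp \<Phi> (Disj \<phi> \<psi>) = Disj (sharp \<Phi> \<phi>) (sharp \<Phi> \<psi>)"
| "sharp \<Phi> (Ex x \<phi>) = Ex x (Conj (inst (t_univ \<Phi>) [Var x]) (sharp \<Phi> \<phi>))"
| "sharp \<Phi> (All x \<phi>) = All x (Imp (inst (t_univ \<Phi>) [Var x]) (sharp \<Phi> \<phi>))"
| "sharp \<Phi> (Ex2 X \<phi>) = Ex2 X (sharp \<Phi> \<phi>)"
| "sharp \<Phi> (All2 X \<phi>) = All2 X (sharp \<Phi> \<phi>)"

locale tame_fragment = fragment +
  assumes sharp_closed: "vocabulary \<tau> \<Longrightarrow> vocabulary \<sigma> \<Longrightarrow> transduction L \<tau> \<sigma> \<Phi> \<Longrightarrow>
      \<theta> \<in> Lang L \<sigma> \<Longrightarrow> sharp \<Phi> \<theta> \<in> Lang L \<tau>"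
    and All_Imp_closed: "vocabulary \<tau> \<Longrightarrow> \<phi> \<in> Lang L \<tau> \<Longrightarrow> \<psi> \<in> Lang L \<tau> \<Longrightarrow>
      All x (Imp \<phi> \<psi>) \<in> L"


section \<open>Rich disjoint union, smooth and sum-like operations\<close>

definition rich_vocab :: "vocab \<Rightarrow> vocab" where
  "rich_vocab \<tau> = \<lparr>rels = RIn ` rels \<tau> \<union> {PLeft, PRight}, csts = CLeft ` csts \<tau> \<union> CRight ` csts \<tau>\<rparr>"

abbreviation inl :: "nat \<Rightarrow> nat" where "inl a \<equiv> sum_encode (Inl a)"

abbreviation inr :: "nat \<Rightarrow> nat" where "inr a \<equiv> sum_encode (Inr a)"

primrec rich_rel :: "struct \<Rightarrow> struct \<Rightarrow> rsym \<Rightarrow> nat list set" where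
  "rich_rel A B (RSym n k) = {}"
| "rich_rel A B (RIn R) = map inl ` rel A R \<union> map inr ` rel B R"
| "rich_rel A B PLeft = {[inl a] | a. a \<in> univ A}"
| "rich_rel A B PRight = {[inr b] | b. b \<in> univ B}"

primrec rich_cst :: "struct \<Rightarrow> struct \<Rightarrow> csym \<Rightarrow> nat" where
  "rich_cst A B (CSym n) = undefined"
| "rich_cst A B (CLeft c) = inl (cst A c)"
| "rich_cst A B (CRight c) = inr (cst B c)"

definition rich_union :: "struct \<Rightarrow> struct \<Rightarrow> struct" where
  "rich_union A B =
     \<lparr>univ = inl ` univ A \<union> inr ` univ B, rel = rich_rel A B, cst = rich_cst A B\<rparr>"

definition q_equiv :: "form set \<Rightarrow> (form \<Rightarrow> nat) \<Rightarrow> vocab \<Rightarrow> nat \<Rightarrow> struct \<Rightarrow> struct \<Rightarrow> bool" where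
  "q_equiv L qr \<tau> q A B \<longleftrightarrow>
     (\<forall>\<phi>. sentence L \<tau> \<phi> \<and> qr \<phi> \<le> q \<longrightarrow> models A \<phi> = models B \<phi>)"

text \<open>\<open>opn\<close> maps pairs of \<open>\<tau>\<close>-structures to \<open>\<sigma>\<close>-structures.\<close>

definition smooth ::
  "form set \<Rightarrow> (form \<Rightarrow> nat) \<Rightarrow> vocab \<Rightarrow> vocab \<Rightarrow> (struct \<Rightarrow> struct \<Rightarrow> struct) \<Rightarrow> bool" where
  "smooth L qr \<tau> \<sigma> opn \<longleftrightarrow>
     (\<forall>q. \<forall>A1\<in>Str \<tau>. \<forall>A2\<in>Str \<tau>. \<forall>B1\<in>Str \<tau>. \<forall>B2\<in>Str \<tau>.
        q_equiv L qr \<tau> q A1 B1 \<longrightarrow> q_equiv L qr \<tau> q A2 B2 \<longrightarrow>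
        q_equiv L qr \<sigma> q (opn A1 A2) (opn B1 B2))"

definition rich_union_smooth :: "form set \<Rightarrow> (form \<Rightarrow> nat) \<Rightarrow> bool" where
  "rich_union_smooth L qr \<longleftrightarrow>
     (\<forall>\<tau>. vocabulary \<tau> \<longrightarrow> smooth L qr \<tau> (rich_vocab \<tau>) rich_union)"

text \<open>Disjoint unions being defined up to isomorphism, so is the equation for a sum-like operation.\<close>

definition sum_like :: "form set \<Rightarrow> vocab \<Rightarrow> (struct \<Rightarrow> struct \<Rightarrow> struct) \<Rightarrow> bool" where
  "sum_like L \<tau> opn \<longleftrightarrow>
     (\<exists>\<Phi>. transduction L (rich_vocab \<tau>) \<tau> \<Phi> \<and>
        (\<forall>A\<in>Str \<tau>. \<forall>B\<in>Str \<tau>. isomorphic \<tau> (opn A B) (star \<Phi> (rich_union A B))))"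


section \<open>Polynomials definable in a fragment\<close>

text \<open>
  \<open>ProdC a \<phi> t\<close> is the product of \<open>t\<close> over all interpretations of the constant \<open>a\<close> satisfying \<open>\<phi>\<close>;
  \<open>SumC as \<phi> p\<close> and \<open>SumR Rs \<phi> p\<close> are the sums of \<open>p\<close> over all interpretations of the constants
  \<open>as\<close>, respectively of the relation symbols \<open>Rs\<close>, satisfying \<open>\<phi>\<close>.
\<close>

datatype 'x smono = Num nat | Ind 'x

datatype 'x mono = Simple "'x smono" | ProdC csym form "'x smono" | Times "'x mono" "'x mono"

datatype 'x lpoly = Mono "'x mono" | SumC "csym list" form "'x lpoly" | SumR "rsym list" form "'x lpoly"

definition add_csts :: "vocab \<Rightarrow> csym list \<Rightarrow> vocab" where
  "add_csts \<tau> cs = \<tau>\<lparr>csts := csts \<tau> \<union> set cs\<rparr>"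

definition add_rels :: "vocab \<Rightarrow> rsym list \<Rightarrow> vocab" where
  "add_rels \<tau> Rs = \<tau>\<lparr>rels := rels \<tau> \<union> set Rs\<rparr>"

primrec is_mono :: "form set \<Rightarrow> vocab \<Rightarrow> 'x mono \<Rightarrow> bool" where
  "is_mono L \<tau> (Simple t) = True"
| "is_mono L \<tau> (ProdC a \<phi> t) = (a \<notin> csts \<tau> \<and> sentence L (add_csts \<tau> [a]) \<phi>)"
| "is_mono L \<tau> (Times m n) = (is_mono L \<tau> m \<and> is_mono L \<tau> n)"

text \<open>
  Summation is over elements and over relations of arity at most one (sets). The arity bound is
  indispensable: every tame fragment can express that a binary relation is a linear order, and
  the sum of \<open>1\<close> over all linear orders of the universe is the factorial of its size, for which
  the connection matrix of the disjoint union has infinite rank.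
\<close>

primrec is_lpoly :: "form set \<Rightarrow> vocab \<Rightarrow> 'x lpoly \<Rightarrow> bool" where
  "is_lpoly L \<tau> (Mono m) = is_mono L \<tau> m"
| "is_lpoly L \<tau> (SumC cs \<phi> p) =
     (distinct cs \<and> set cs \<inter> csts \<tau> = {} \<and>
      sentence L (add_csts \<tau> cs) \<phi> \<and> is_lpoly L (add_csts \<tau> cs) p)"
| "is_lpoly L \<tau> (SumR Rs \<phi> p) =
     (distinct Rs \<and> set Rs \<inter> rels \<tau> = {} \<and> (\<forall>R\<in>set Rs. arity R \<le> 1) \<and>
      sentence L (add_rels \<tau> Rs) \<phi> \<and> is_lpoly L (add_rels \<tau> Rs) p)"

text \<open>The polynomial ring \<open>\<rat>[X]\<close> and its field of fractions \<open>\<rat>(X)\<close>, where \<open>X\<close> is the type \<open>'x\<close>.\<close>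

type_synonym 'x mpoly = "('x \<Rightarrow>\<^sub>0 nat) \<Rightarrow>\<^sub>0 rat"

type_synonym 'x ratfun = "'x mpoly fract"

definition set_csts :: "struct \<Rightarrow> csym list \<Rightarrow> nat list \<Rightarrow> struct" where
  "set_csts M cs as = M\<lparr>cst := (\<lambda>c. case map_of (zip cs as) c of None \<Rightarrow> cst M c | Some a \<Rightarrow> a)\<rparr>"

definition set_rels :: "struct \<Rightarrow> rsym list \<Rightarrow> nat list set list \<Rightarrow> struct" where
  "set_rels M Rs Vs = M\<lparr>rel := (\<lambda>R. case map_of (zip Rs Vs) R of None \<Rightarrow> rel M R | Some V \<Rightarrow> V)\<rparr>"

definition rel_tuples :: "nat set \<Rightarrow> rsym list \<Rightarrow> nat list set list set" where
  "rel_tuples U Rs = {Vs. list_all2 (\<lambda>R V. V \<subseteq> tuples U (arity R)) Rs Vs}"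

primrec smono_val :: "'x::linorder smono \<Rightarrow> 'x mpoly" where
  "smono_val (Num n) = of_nat n"
| "smono_val (Ind x) = Poly_Mapping.single (Poly_Mapping.single x 1) 1"

primrec mono_val :: "struct \<Rightarrow> 'x::linorder mono \<Rightarrow> 'x mpoly" where
  "mono_val M (Simple t) = smono_val t"
| "mono_val M (ProdC a \<phi> t) = (\<Prod>x\<in>{x\<in>univ M. models (set_csts M [a] [x]) \<phi>}. smono_val t)"
| "mono_val M (Times m n) = mono_val M m * mono_val M n"

primrec lpoly_val :: "struct \<Rightarrow> 'x::linorder lpoly \<Rightarrow> 'x mpoly" where
  "lpoly_val M (Mono m) = mono_val M m"
| "lpoly_val M (SumC cs \<phi> p) =
     (\<Sum>as\<in>{as\<in>tuples (univ M) (length cs). models (set_csts M cs as) \<phi>}.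
        lpoly_val (set_csts M cs as) p)"
| "lpoly_val M (SumR Rs \<phi> p) =
     (\<Sum>Vs\<in>{Vs\<in>rel_tuples (univ M) Rs. models (set_rels M Rs Vs) \<phi>}.
        lpoly_val (set_rels M Rs Vs) p)"


section \<open>Connection matrices and rank\<close>

definition connection_matrix ::
  "(struct \<Rightarrow> struct \<Rightarrow> struct) \<Rightarrow> 'x::linorder lpoly \<Rightarrow> struct \<Rightarrow> struct \<Rightarrow> 'x ratfun" where
  "connection_matrix opn P A B = Fract (lpoly_val (opn A B) P) 1"

text \<open>
  The rank of a possibly infinite matrix \<open>M\<close> with rows indexed by \<open>I\<close> and columns by \<open>J\<close> is the
  supremum of the sizes of the finite linearly independent sets of rows.
\<close>

definition matrix_row :: "'j set \<Rightarrow> ('i \<Rightarrow> 'j \<Rightarrow> 'k::field) \<Rightarrow> 'i \<Rightarrow> 'j \<Rightarrow> 'k" where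
  "matrix_row J M i = (\<lambda>j. if j \<in> J then M i j else 0)"

definition lin_dependent :: "('j \<Rightarrow> 'k::field) set \<Rightarrow> bool" where
  "lin_dependent = module.dependent (\<lambda>c v j. c * v j)"

definition matrix_rank :: "'i set \<Rightarrow> 'j set \<Rightarrow> ('i \<Rightarrow> 'j \<Rightarrow> 'k::field) \<Rightarrow> enat" where
  "matrix_rank I J M =
     (SUP S\<in>{S. S \<subseteq> matrix_row J M ` I \<and> finite S \<and> \<not> lin_dependent S}. enat (card S))"

end

theory Submission
  imports Defs
begin

text \<open>
  Call a function of two structures separable if it is a finite sum of products \<open>f A * g B\<close>; the
  rows of the matrix of a separable function lie in the span of the finitely many \<open>g\<close>. We show by
  induction on \<open>P\<close> that the value of \<open>P\<close> in \<open>\<Phi>\<^sup>\<star>(A \<squnion> B)\<close> is separable. By tameness and smoothness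
  the truth of a sentence in \<open>\<Phi>\<^sup>\<star>(A \<squnion> B)\<close> depends only on the types of \<open>A\<close> and \<open>B\<close> of some
  quantifier rank, of which there are finitely many, so its indicator function is separable. The
  sum over an element \<open>a\<close> of \<open>\<Phi>\<^sup>\<star>(A \<squnion> B)\<close> splits according to whether \<open>a\<close> lies in \<open>A\<close> or in \<open>B\<close>, and
  the sum over a set splits into a double sum over a subset of \<open>A\<close> and a subset of \<open>B\<close>. In both cases
  the expansion of \<open>\<Phi>\<^sup>\<star>(A \<squnion> B)\<close> is a transduction of the rich union of an expansion of \<open>A\<close> and an
  expansion of \<open>B\<close>. To keep both over the same vocabulary, the new constant is interpreted by a dummy
  element in the part that does not contain \<open>a\<close>.
\<close>

section \<open>Semantics of second-order formulas\<close>

lemma finite_fv: "finite (fv \<phi>)"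
proof -
  have "finite (tm_vars t)" for t by (cases t) auto
  then show ?thesis by (induction \<phi>) auto
qed

lemma sat_cong:
  assumes "\<And>x. x \<in> fv \<phi> \<Longrightarrow> s x = s' x" and "\<And>X. X \<in> frv \<phi> \<Longrightarrow> e X = e' X"
  shows "sat A s e \<phi> = sat A s' e' \<phi>"
proof -
  have tval_cong: "tval A s t = tval A s' t" if "\<And>x. x \<in> tm_vars t \<Longrightarrow> s x = s' x" for s s' t
    using that by (cases t) auto
  show ?thesis
    using assms
  proof (induction \<phi> arbitrary: s s' e e')
    case (Eq t u)
    then show ?case by (simp add: tval_cong[of t s s'] tval_cong[of u s s'])
  next
    case (Rel R ts)
    then have "map (tval A s) ts = map (tval A s') ts" by (auto intro!: tval_cong)
    then show ?case by (simp del: map_eq_conv)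
  next
    case (RVar X ts)
    then have "map (tval A s) ts = map (tval A s') ts" by (auto intro!: tval_cong)
    then show ?case using RVar by (simp del: map_eq_conv)
  next
    case (Neg \<phi>)
    have "sat A s e \<phi> = sat A s' e' \<phi>" by (rule Neg.IH) (use Neg.prems in auto)
    then show ?case by simp
  next
    case (Conj \<phi> \<psi>)
    have "sat A s e \<phi> = sat A s' e' \<phi>" by (rule Conj.IH) (use Conj.prems in auto)
    moreover have "sat A s e \<psi> = sat A s' e' \<psi>" by (rule Conj.IH) (use Conj.prems in auto)
    ultimately show ?case by simp
  next
    case (Disj \<phi> \<psi>)
    have "sat A s e \<phi> = sat A s' e' \<phi>" by (rule Disj.IH) (use Disj.prems in auto)
    moreover have "sat A s e \<psi> = sat A s' e' \<psi>" by (rule Disj.IH) (use Disj.prems in auto)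
    ultimately show ?case by simp
  next
    case (Ex x \<phi>)
    have "sat A (s(x := a)) e \<phi> = sat A (s'(x := a)) e' \<phi>" for a
      by (rule Ex.IH) (use Ex.prems in auto)
    then show ?case by simp
  next
    case (All x \<phi>)
    have "sat A (s(x := a)) e \<phi> = sat A (s'(x := a)) e' \<phi>" for a
      by (rule All.IH) (use All.prems in auto)
    then show ?case by simp
  next
    case (Ex2 X \<phi>)
    have "sat A s (e(X := V)) \<phi> = sat A s' (e'(X := V)) \<phi>" for V
      by (rule Ex2.IH) (use Ex2.prems in auto)
    then show ?case by simp
  next
    case (All2 X \<phi>)
    have "sat A s (e(X := V)) \<phi> = sat A s' (e'(X := V)) \<phi>" for V
      by (rule All2.IH) (use All2.prems in auto)
    then show ?case by simp
  qed
qed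

section \<open>Capture-avoiding substitution\<close>

lemma fresh_not_in:
  assumes "finite V" "z \<in> V"
  shows "fresh s V \<notin> tm_vars (s z)"
proof -
  have "finite (tm_vars t)" for t by (cases t) auto
  then have "finite (\<Union>x\<in>V. tm_vars (s x))" using assms(1) by blast
  then have "\<exists>y. y \<notin> (\<Union>x\<in>V. tm_vars (s x))" using ex_new_if_finite infinite_UNIV_nat by blast
  from LeastI_ex[OF this] show ?thesis using assms(2) by (auto simp: fresh_def)
qed

lemma tval_update: "y \<notin> tm_vars t \<Longrightarrow> tval A (s(y := a)) t = tval A s t"
  by (cases t) auto

text \<open>Under a quantifier the bound variable becomes \<open>y\<close>, which does not occur in
  the terms substituted for the other free variables. Updating the assignment at \<open>y\<close>
  leaves their values alone, so \<open>sat_cong\<close> applies.\<close>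

lemma sat_subst: "sat A s e (subst \<sigma> \<phi>) = sat A (\<lambda>x. tval A s (\<sigma> x)) e \<phi>"
proof (induction \<phi> arbitrary: s e \<sigma>)
  case (Eq t u)
  have "tval A s (tm_subst \<sigma> t) = tval A (\<lambda>x. tval A s (\<sigma> x)) t" for t by (cases t) auto
  then show ?case by simp
next
  case (Rel R ts)
  have "tval A s (tm_subst \<sigma> t) = tval A (\<lambda>x. tval A s (\<sigma> x)) t" for t by (cases t) auto
  then show ?case by (simp add: comp_def)
next
  case (RVar X ts)
  have "tval A s (tm_subst \<sigma> t) = tval A (\<lambda>x. tval A s (\<sigma> x)) t" for t by (cases t) auto
  then show ?case by (simp add: comp_def)
next
  case (Ex x \<phi>)
  define y where "y = fresh \<sigma> (fv \<phi> - {x})"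
  have "sat A (s(y := a)) e (subst (\<sigma>(x := Var y)) \<phi>) = sat A ((\<lambda>x. tval A s (\<sigma> x))(x := a)) e \<phi>" for a
    unfolding Ex.IH
    by (rule sat_cong)
      (use fresh_not_in[of "fv \<phi> - {x}" _ \<sigma>] in \<open>auto simp: y_def finite_fv tval_update\<close>)
  then show ?case by (simp add: Let_def flip: y_def)
next
  case (All x \<phi>)
  define y where "y = fresh \<sigma> (fv \<phi> - {x})"
  have "sat A (s(y := a)) e (subst (\<sigma>(x := Var y)) \<phi>) = sat A ((\<lambda>x. tval A s (\<sigma> x))(x := a)) e \<phi>" for a
    unfolding All.IH
    by (rule sat_cong)
      (use fresh_not_in[of "fv \<phi> - {x}" _ \<sigma>] in \<open>auto simp: y_def finite_fv tval_update\<close>)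
  then show ?case by (simp add: Let_def flip: y_def)
qed simp_all

text \<open>The bound on the free variables ensures that the default \<open>Var i\<close> in
  \<open>inst\<close> is never reached, so \<open>s\<close> enters only through the values of
  \<open>ts\<close>.\<close>

lemma sat_inst:
  assumes "fv \<phi> \<subseteq> {..<length ts}" "frv \<phi> = {}"
  shows "sat A s e (inst \<phi> ts) = holds A \<phi> (map (tval A s) ts)"
  unfolding inst_def sat_subst holds_def by (rule sat_cong) (use assms in auto)

lemma tm_vars_tm_subst: "tm_vars (tm_subst \<sigma> t) = (\<Union>x\<in>tm_vars t. tm_vars (\<sigma> x))"
  by (cases t) auto

lemma fv_subst: "fv (subst \<sigma> \<phi>) \<subseteq> (\<Union>x\<in>fv \<phi>. tm_vars (\<sigma> x))"
proof (induction \<phi> arbitrary: \<sigma>)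
  case (Ex x \<phi>)
  then show ?case
    using Ex.IH[of "\<sigma>(x := Var (fresh \<sigma> (fv \<phi> - {x})))"] by (fastforce simp: Let_def split: if_splits)
next
  case (All x \<phi>)
  then show ?case
    using All.IH[of "\<sigma>(x := Var (fresh \<sigma> (fv \<phi> - {x})))"] by (fastforce simp: Let_def split: if_splits)
qed (fastforce simp: tm_vars_tm_subst)+

lemma frv_subst: "frv (subst \<sigma> \<phi>) = frv \<phi>"
  by (induction \<phi> arbitrary: \<sigma>) (auto simp: Let_def)

lemma fv_inst:
  assumes "fv \<phi> \<subseteq> {..<length ts}"
  shows "fv (inst \<phi> ts) \<subseteq> (\<Union>t\<in>set ts. tm_vars t)"
proof
  fix y assume "y \<in> fv (inst \<phi> ts)"
  then obtain x where "x \<in> fv \<phi>" "y \<in> tm_vars (if x < length ts then ts ! x else Var x)"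
    unfolding inst_def using fv_subst by blast
  then show "y \<in> (\<Union>t\<in>set ts. tm_vars t)" using assms by (auto split: if_splits)
qed

lemma frv_inst: "frv (inst \<phi> ts) = frv \<phi>"
  by (simp add: inst_def frv_subst)

lemma tm_vars_rename_tm: "tm_vars (rename_tm \<kappa> t) = tm_vars t"
  by (cases t) auto

section \<open>Reducts and isomorphisms\<close>

definition agree :: "vocab \<Rightarrow> struct \<Rightarrow> struct \<Rightarrow> bool" where
  "agree \<tau> A B \<longleftrightarrow> univ A = univ B \<and> (\<forall>R\<in>rels \<tau>. rel A R = rel B R) \<and> (\<forall>c\<in>csts \<tau>. cst A c = cst B c)"

text \<open>Records also store values at symbols outside the vocabulary, and these differ between a
  structure and its expansions. \<open>agree\<close> is equality up to such values, which a formula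
  over \<open>\<tau>\<close> never reads.\<close>

lemma sat_agree:
  assumes "agree \<tau> A B" "over \<tau> \<phi>"
  shows "sat A s e \<phi> = sat B s e \<phi>"
proof -
  have tval: "tval A s t = tval B s t" if "tm_over \<tau> t" for s t
    using that assms(1) by (cases t) (auto simp: agree_def)
  have map_tval: "map (tval A s) ts = map (tval B s) ts" if "\<forall>t\<in>set ts. tm_over \<tau> t" for s ts
    using that by (auto intro: tval)
  show ?thesis
    using assms(2)
  proof (induction \<phi> arbitrary: s e)
    case (Rel R ts)
    then show ?case using map_tval[of ts s] assms(1) by (simp add: agree_def del: map_eq_conv)
  next
    case (RVar X ts)
    then show ?case using map_tval[of ts s] by (simp del: map_eq_conv)
  qed (use assms(1) in \<open>auto simp: tval agree_def\<close>)
qed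

lemma holds_agree: "agree \<tau> A B \<Longrightarrow> over \<tau> \<phi> \<Longrightarrow> holds A \<phi> as = holds B \<phi> as"
  by (simp add: holds_def sat_agree)

text \<open>A transduced structure \<open>star \<Phi> C\<close> may have an empty universe, or
  constants outside its universe, and so need not lie in \<open>Str\<close>. This isolates the
  condition on the constants.\<close>

definition cst_closed :: "vocab \<Rightarrow> struct \<Rightarrow> bool" where
  "cst_closed \<tau> A \<longleftrightarrow> (\<forall>c\<in>csts \<tau>. cst A c \<in> univ A)"

text \<open>Unlike in \<open>isomorphic\<close>, the bijection is named, so that the same
  \<open>f\<close> also serves the expansions by \<open>a\<close> and \<open>f a\<close>, or by
  \<open>V\<close> and its image.\<close>

definition iso_by :: "vocab \<Rightarrow> (nat \<Rightarrow> nat) \<Rightarrow> struct \<Rightarrow> struct \<Rightarrow> bool" where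
  "iso_by \<tau> f A B \<longleftrightarrow>
     bij_betw f (univ A) (univ B) \<and>
     (\<forall>R\<in>rels \<tau>. \<forall>as\<in>tuples (univ A) (arity R). as \<in> rel A R \<longleftrightarrow> map f as \<in> rel B R) \<and>
     (\<forall>c\<in>csts \<tau>. f (cst A c) = cst B c)"

lemma bij_betw_tuples:
  assumes "bij_betw f U W"
  shows "bij_betw (map f) (tuples U k) (tuples W k)"
proof -
  have inj: "inj_on f U" and W: "W = f ` U" using assms by (auto simp: bij_betw_def)
  have "inj_on (map f) (tuples U k)"
    by (rule inj_on_subset[OF inj_on_mapI[of f "tuples U k"]])
      (auto simp: tuples_def intro: inj_on_subset[OF inj])
  moreover have "map f ` tuples U k = tuples W k"
  proof
    show "map f ` tuples U k \<subseteq> tuples W k" by (fastforce simp: tuples_def W)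
    show "tuples W k \<subseteq> map f ` tuples U k"
    proof
      fix bs assume bs: "bs \<in> tuples W k"
      then have "bs = map f (map (inv_into U f) bs)" "map (inv_into U f) bs \<in> tuples U k"
        by (auto simp: tuples_def W f_inv_into_f inv_into_into subset_iff intro!: map_idI[symmetric])
      then show "bs \<in> map f ` tuples U k" by blast
    qed
  qed
  ultimately show ?thesis by (simp add: bij_betw_def)
qed

text \<open>Quantified elements correspond under \<open>f\<close>, quantified relations under
  images. Assignments are constrained at free variables only, because a sentence is evaluated under
  \<open>nth []\<close>, whose values may lie outside the universe.\<close>

lemma sat_iso:
  assumes iso: "iso_by \<tau> f A B" and closed: "cst_closed \<tau> A" and "over \<tau> \<phi>"
    and "\<And>x. x \<in> fv \<phi> \<Longrightarrow> s x \<in> univ A \<and> s' x = f (s x)"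
    and "\<And>X as. X \<in> frv \<phi> \<Longrightarrow> as \<in> tuples (univ A) (snd X) \<Longrightarrow> as \<in> e X \<longleftrightarrow> map f as \<in> e' X"
  shows "sat A s e \<phi> = sat B s' e' \<phi>"
proof -
  have bij: "bij_betw f (univ A) (univ B)" using iso by (simp add: iso_by_def)
  then have inj: "inj_on f (univ A)" and ran: "univ B = f ` univ A" by (auto simp: bij_betw_def)
  have tval: "tval A s t \<in> univ A \<and> tval B s' t = f (tval A s t)"
    if "tm_over \<tau> t" "\<And>x. x \<in> tm_vars t \<Longrightarrow> s x \<in> univ A \<and> s' x = f (s x)" for s s' t
    using that iso closed by (cases t) (auto simp: iso_by_def cst_closed_def)
  have map_tval: "map (tval A s) ts \<in> tuples (univ A) (length ts) \<and>
      map (tval B s') ts = map f (map (tval A s) ts)"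
    if "\<forall>t\<in>set ts. tm_over \<tau> t" "\<And>x. x \<in> (\<Union>t\<in>set ts. tm_vars t) \<Longrightarrow> s x \<in> univ A \<and> s' x = f (s x)"
    for s s' ts
    using that tval[of _ s s'] by (force simp: tuples_def)
  have fst_ord: "sat A (s(x := a)) e \<phi> = sat B (s'(x := f a)) e' \<phi>"
    if "\<And>s s' e e'. over \<tau> \<phi> \<Longrightarrow> (\<And>x. x \<in> fv \<phi> \<Longrightarrow> s x \<in> univ A \<and> s' x = f (s x)) \<Longrightarrow>
        (\<And>X as. X \<in> frv \<phi> \<Longrightarrow> as \<in> tuples (univ A) (snd X) \<Longrightarrow> as \<in> e X \<longleftrightarrow> map f as \<in> e' X) \<Longrightarrow>
        sat A s e \<phi> = sat B s' e' \<phi>"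
      and "over \<tau> \<phi>" "\<And>y. y \<in> fv \<phi> - {x} \<Longrightarrow> s y \<in> univ A \<and> s' y = f (s y)"
      and "\<And>X as. X \<in> frv \<phi> \<Longrightarrow> as \<in> tuples (univ A) (snd X) \<Longrightarrow> as \<in> e X \<longleftrightarrow> map f as \<in> e' X"
      and "a \<in> univ A" for \<phi> s s' e e' x a
    by (rule that(1)) (use that(2-) in auto)
  have snd_ord: "sat A s (e(X := V)) \<phi> = sat B s' (e'(X := map f ` V)) \<phi>"
    if "\<And>s s' e e'. over \<tau> \<phi> \<Longrightarrow> (\<And>x. x \<in> fv \<phi> \<Longrightarrow> s x \<in> univ A \<and> s' x = f (s x)) \<Longrightarrow>
        (\<And>X as. X \<in> frv \<phi> \<Longrightarrow> as \<in> tuples (univ A) (snd X) \<Longrightarrow> as \<in> e X \<longleftrightarrow> map f as \<in> e' X) \<Longrightarrow>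
        sat A s e \<phi> = sat B s' e' \<phi>"
      and "over \<tau> \<phi>" "\<And>y. y \<in> fv \<phi> \<Longrightarrow> s y \<in> univ A \<and> s' y = f (s y)"
      and "\<And>Y as. Y \<in> frv \<phi> - {X} \<Longrightarrow> as \<in> tuples (univ A) (snd Y) \<Longrightarrow> as \<in> e Y \<longleftrightarrow> map f as \<in> e' Y"
      and "V \<subseteq> tuples (univ A) (snd X)" for \<phi> s s' e e' X V
  proof (rule that(1))
    fix Y as assume Y: "Y \<in> frv \<phi>" "as \<in> tuples (univ A) (snd Y)"
    have "inj_on (map f) (tuples (univ A) (snd X))"
      using bij_betw_tuples[OF bij] by (auto simp: bij_betw_def)
    then show "as \<in> (e(X := V)) Y \<longleftrightarrow> map f as \<in> (e'(X := map f ` V)) Y"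
      using Y that(4,5) by (cases "Y = X") (auto dest: inj_onD)
  qed (use that(2,3) in auto)
  \<comment> \<open>Relation quantifiers correspond because every set of tuples over
    \<open>univ B\<close> is the image under \<open>map f\<close> of a set of tuples over
    \<open>univ A\<close>.\<close>
  have images: "{V. V \<subseteq> tuples (univ B) k} = image (map f) ` {V. V \<subseteq> tuples (univ A) k}" for k
  proof -
    have "tuples (univ B) k = map f ` tuples (univ A) k"
      using bij_betw_tuples[OF bij] by (auto simp: bij_betw_def)
    then show ?thesis by (auto simp: subset_image_iff image_iff)
  qed
  have ex2: "(\<exists>V\<subseteq>tuples (univ B) k. p V) = (\<exists>V\<subseteq>tuples (univ A) k. p (map f ` V))" for k p
    using images[of k] by (smt (verit) image_iff mem_Collect_eq)
  have all2: "(\<forall>V\<subseteq>tuples (univ B) k. p V) = (\<forall>V\<subseteq>tuples (univ A) k. p (map f ` V))" for k p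
    using ex2[of k "\<lambda>V. \<not> p V"] by blast
  show ?thesis
    using assms(3-)
  proof (induction \<phi> arbitrary: s s' e e')
    case (Eq t u)
    then have "tval A s t \<in> univ A \<and> tval B s' t = f (tval A s t)"
      "tval A s u \<in> univ A \<and> tval B s' u = f (tval A s u)"
      by (auto intro!: tval)
    then show ?case using inj by (auto dest: inj_onD)
  next
    case (Rel R ts)
    then show ?case using map_tval[of ts s s'] iso by (simp add: iso_by_def del: map_map map_eq_conv)
  next
    case (RVar X ts)
    then show ?case using map_tval[of ts s s'] by (simp del: map_map map_eq_conv)
  next
    case (Neg \<phi>)
    have "sat A s e \<phi> = sat B s' e' \<phi>" by (rule Neg.IH) (use Neg.prems in auto)
    then show ?case by simp
  next
    case (Conj \<phi> \<psi>)
    have "sat A s e \<phi> = sat B s' e' \<phi>" by (rule Conj.IH) (use Conj.prems in auto)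
    moreover have "sat A s e \<psi> = sat B s' e' \<psi>" by (rule Conj.IH) (use Conj.prems in auto)
    ultimately show ?case by simp
  next
    case (Disj \<phi> \<psi>)
    have "sat A s e \<phi> = sat B s' e' \<phi>" by (rule Disj.IH) (use Disj.prems in auto)
    moreover have "sat A s e \<psi> = sat B s' e' \<psi>" by (rule Disj.IH) (use Disj.prems in auto)
    ultimately show ?case by simp
  next
    case (Ex x \<phi>)
    have "sat A (s(x := a)) e \<phi> = sat B (s'(x := f a)) e' \<phi>" if "a \<in> univ A" for a
      by (rule fst_ord[OF Ex.IH]) (use Ex.prems that in auto)
    then show ?case by (auto simp: ran)
  next
    case (All x \<phi>)
    have "sat A (s(x := a)) e \<phi> = sat B (s'(x := f a)) e' \<phi>" if "a \<in> univ A" for a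
      by (rule fst_ord[OF All.IH]) (use All.prems that in auto)
    then show ?case by (auto simp: ran)
  next
    case (Ex2 X \<phi>)
    have "sat A s (e(X := V)) \<phi> = sat B s' (e'(X := map f ` V)) \<phi>" if "V \<subseteq> tuples (univ A) (snd X)" for V
      by (rule snd_ord[OF Ex2.IH]) (use Ex2.prems that in auto)
    then show ?case by (auto simp: ex2)
  next
    case (All2 X \<phi>)
    have "sat A s (e(X := V)) \<phi> = sat B s' (e'(X := map f ` V)) \<phi>" if "V \<subseteq> tuples (univ A) (snd X)" for V
      by (rule snd_ord[OF All2.IH]) (use All2.prems that in auto)
    then show ?case by (auto simp: all2)
  qed
qed

lemma models_iso:
  assumes "iso_by \<tau> f A B" "cst_closed \<tau> A" "sentence L \<tau> \<phi>"
  shows "models A \<phi> = models B \<phi>"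
  unfolding holds_def
  by (rule sat_iso[OF assms(1,2)]) (use assms(3) in \<open>auto simp: param_form_def Lang_def\<close>)


section \<open>The backward translation\<close>

lemma univ_star: "univ (star \<Phi> C) = {a \<in> univ C. holds C (t_univ \<Phi>) [a]}"
  by (simp add: star_def Let_def)

lemma rel_star: "rel (star \<Phi> C) R = {as \<in> tuples (univ (star \<Phi> C)) (arity R). holds C (t_rel \<Phi> R) as}"
  by (simp add: star_def Let_def)

lemma cst_star: "cst (star \<Phi> C) c = cst C (t_cst \<Phi> c)"
  by (simp add: star_def Let_def)

lemma sharp_free:
  assumes "transduction L \<tau> \<sigma> \<Phi>" "over \<sigma> \<theta>"
  shows "fv (sharp \<Phi> \<theta>) \<subseteq> fv \<theta> \<and> frv (sharp \<Phi> \<theta>) \<subseteq> frv \<theta>"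
proof -
  have univ: "fv (inst (t_univ \<Phi>) [Var x]) \<subseteq> {x}" "frv (inst (t_univ \<Phi>) [Var x]) = {}" for x
    using assms(1) fv_inst[of "t_univ \<Phi>" "[Var x]"]
    by (auto simp: transduction_def param_form_def frv_inst)
  show ?thesis
    using assms(2)
  proof (induction \<theta>)
    case (Rel R ts)
    then show ?case
      using assms(1) fv_inst[of "t_rel \<Phi> R" "map (rename_tm (t_cst \<Phi>)) ts"]
      by (auto simp: transduction_def param_form_def frv_inst tm_vars_rename_tm)
  qed (use univ in \<open>auto simp: tm_vars_rename_tm\<close>)
qed

text \<open>All terms take values in the new universe, so a relation variable is tested only on
  tuples over it. Hence \<open>e'\<close> may be the restriction of \<open>e\<close>, and
  quantifying over relations on the old universe amounts to quantifying over their traces on the new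
  one.\<close>

lemma sat_sharp:
  assumes \<Phi>: "transduction L \<tau> \<sigma> \<Phi>" and closed: "cst_closed \<sigma> (star \<Phi> C)" and "over \<sigma> \<theta>"
    and "\<And>x. x \<in> fv \<theta> \<Longrightarrow> s x \<in> univ (star \<Phi> C)"
    and "\<And>X. X \<in> frv \<theta> \<Longrightarrow> e' X = e X \<inter> tuples (univ (star \<Phi> C)) (snd X)"
  shows "sat C s e (sharp \<Phi> \<theta>) = sat (star \<Phi> C) s e' \<theta>"
proof -
  let ?M = "star \<Phi> C"
  have tval_eq: "tval C s (rename_tm (t_cst \<Phi>) t) = tval ?M s t" for s t
    by (cases t) (auto simp: cst_star)
  have tuple: "map (tval ?M s) ts \<in> tuples (univ ?M) (length ts)"
    if "\<forall>t\<in>set ts. tm_over \<sigma> t" "\<And>x. x \<in> (\<Union>t\<in>set ts. tm_vars t) \<Longrightarrow> s x \<in> univ ?M" for s ts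
  proof -
    note over = that(1) and vars = that(2)
    have "tval ?M s t \<in> univ ?M" if t: "t \<in> set ts" for t
    proof (cases t)
      case (Var x)
      then have "x \<in> (\<Union>t\<in>set ts. tm_vars t)" using t by force
      then show ?thesis using vars Var by simp
    next
      case (Const c)
      then show ?thesis using over t closed by (auto simp: cst_closed_def)
    qed
    then show ?thesis by (auto simp: tuples_def)
  qed
  have univ: "sat C (s(x := a)) e (inst (t_univ \<Phi>) [Var x]) = holds C (t_univ \<Phi>) [a]" for s x a e
    using \<Phi> by (subst sat_inst) (auto simp: transduction_def param_form_def)
  \<comment> \<open>A relation over the new universe is its own trace, and every trace is such a
    relation.\<close>
  have restrict: "(\<exists>V\<subseteq>tuples (univ C) k. p (V \<inter> tuples (univ ?M) k)) = (\<exists>V\<subseteq>tuples (univ ?M) k. p V)" for k p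
  proof -
    have "tuples (univ ?M) k \<subseteq> tuples (univ C) k" by (auto simp: tuples_def univ_star)
    then show ?thesis by (metis inf.absorb1 inf_le2 subset_trans)
  qed
  have restrict': "(\<forall>V\<subseteq>tuples (univ C) k. p (V \<inter> tuples (univ ?M) k)) = (\<forall>V\<subseteq>tuples (univ ?M) k. p V)" for k p
    using restrict[of k "\<lambda>V. \<not> p V"] by blast
  show ?thesis
    using assms(3-)
  proof (induction \<theta> arbitrary: s e e')
    case (Eq t u)
    then show ?case by (simp add: tval_eq)
  next
    case (Rel R ts)
    have "map (tval ?M s) ts \<in> tuples (univ ?M) (arity R)" using tuple[of ts s] Rel by auto
    moreover have "sat C s e (sharp \<Phi> (Rel R ts)) = holds C (t_rel \<Phi> R) (map (tval ?M s) ts)"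
      using \<Phi> Rel by (simp, subst sat_inst)
        (auto simp: transduction_def param_form_def tval_eq comp_def)
    ultimately show ?case by (simp add: rel_star)
  next
    case (RVar X ts)
    have "map (tval ?M s) ts \<in> tuples (univ ?M) (snd X)" using tuple[of ts s] RVar by auto
    then show ?case using RVar by (simp add: tval_eq comp_def)
  next
    case (Neg \<theta>)
    have "sat C s e (sharp \<Phi> \<theta>) = sat ?M s e' \<theta>" by (rule Neg.IH) (use Neg.prems in auto)
    then show ?case by simp
  next
    case (Conj \<theta> \<eta>)
    have "sat C s e (sharp \<Phi> \<theta>) = sat ?M s e' \<theta>" by (rule Conj.IH) (use Conj.prems in auto)
    moreover have "sat C s e (sharp \<Phi> \<eta>) = sat ?M s e' \<eta>" by (rule Conj.IH) (use Conj.prems in auto)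
    ultimately show ?case by simp
  next
    case (Disj \<theta> \<eta>)
    have "sat C s e (sharp \<Phi> \<theta>) = sat ?M s e' \<theta>" by (rule Disj.IH) (use Disj.prems in auto)
    moreover have "sat C s e (sharp \<Phi> \<eta>) = sat ?M s e' \<eta>" by (rule Disj.IH) (use Disj.prems in auto)
    ultimately show ?case by simp
  next
    case (Ex x \<theta>)
    have "sat C (s(x := a)) e (sharp \<Phi> \<theta>) = sat ?M (s(x := a)) e' \<theta>" if "a \<in> univ ?M" for a
      by (rule Ex.IH) (use Ex.prems that in auto)
    then show ?case by (auto simp: univ univ_star)
  next
    case (All x \<theta>)
    have "sat C (s(x := a)) e (sharp \<Phi> \<theta>) = sat ?M (s(x := a)) e' \<theta>" if "a \<in> univ ?M" for a
      by (rule All.IH) (use All.prems that in auto)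
    then show ?case by (auto simp: univ univ_star)
  next
    case (Ex2 X \<theta>)
    have "sat C s (e(X := V)) (sharp \<Phi> \<theta>) =
        sat ?M s (e'(X := V \<inter> tuples (univ ?M) (snd X))) \<theta>" for V
      by (rule Ex2.IH) (use Ex2.prems in auto)
    then show ?case
      using restrict[of "snd X" "\<lambda>V. sat ?M s (e'(X := V)) \<theta>"] by simp
  next
    case (All2 X \<theta>)
    have "sat C s (e(X := V)) (sharp \<Phi> \<theta>) =
        sat ?M s (e'(X := V \<inter> tuples (univ ?M) (snd X))) \<theta>" for V
      by (rule All2.IH) (use All2.prems in auto)
    then show ?case
      using restrict'[of "snd X" "\<lambda>V. sat ?M s (e'(X := V)) \<theta>"] by simp
  qed
qed

lemma models_sharp:
  assumes "transduction L \<tau> \<sigma> \<Phi>" "cst_closed \<sigma> (star \<Phi> C)" "sentence L \<sigma> \<theta>"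
  shows "models C (sharp \<Phi> \<theta>) = models (star \<Phi> C) \<theta>"
  unfolding holds_def
  by (rule sat_sharp[OF assms(1,2)]) (use assms(3) in \<open>auto simp: param_form_def Lang_def\<close>)

lemma (in tame_fragment) sentence_sharp:
  assumes "vocabulary \<tau>" "vocabulary \<sigma>" "transduction L \<tau> \<sigma> \<Phi>" "sentence L \<sigma> \<theta>"
  shows "sentence L \<tau> (sharp \<Phi> \<theta>)"
  using sharp_closed[OF assms(1-3), of \<theta>] sharp_free[OF assms(3), of \<theta>] assms(4)
  by (auto simp: param_form_def Lang_def)

lemma agree_star:
  assumes "agree \<tau> C D" "transduction L \<tau> \<sigma> \<Phi>"
  shows "agree \<sigma> (star \<Phi> C) (star \<Phi> D)"
proof -
  have "univ (star \<Phi> C) = univ (star \<Phi> D)"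
    using assms holds_agree[OF assms(1), of "t_univ \<Phi>"]
    by (auto simp: univ_star agree_def transduction_def param_form_def Lang_def)
  moreover have "rel (star \<Phi> C) R = rel (star \<Phi> D) R" if "R \<in> rels \<sigma>" for R
    using assms that holds_agree[OF assms(1), of "t_rel \<Phi> R"] calculation
    by (auto simp: rel_star transduction_def param_form_def Lang_def)
  ultimately show ?thesis
    using assms by (auto simp: agree_def cst_star transduction_def)
qed


section \<open>Adding one symbol at a time\<close>

lemma set_csts_sel [simp]:
  "univ (set_csts M cs as) = univ M" "rel (set_csts M cs as) = rel M"
  "cst (set_csts M [c] [a]) = (cst M)(c := a)" "set_csts M [] as = M"
  by (auto simp: set_csts_def fun_eq_iff)

lemma set_rels_sel [simp]:
  "univ (set_rels M Rs Vs) = univ M" "cst (set_rels M Rs Vs) = cst M"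
  "rel (set_rels M [R] [V]) = (rel M)(R := V)" "set_rels M [] Vs = M"
  by (auto simp: set_rels_def fun_eq_iff)

lemma add_csts_sel [simp]:
  "rels (add_csts \<tau> cs) = rels \<tau>" "csts (add_csts \<tau> cs) = csts \<tau> \<union> set cs" "add_csts \<tau> [] = \<tau>"
  "add_csts (add_csts \<tau> [c]) cs = add_csts \<tau> (c # cs)"
  by (auto simp: add_csts_def)

lemma add_rels_sel [simp]:
  "csts (add_rels \<tau> Rs) = csts \<tau>" "rels (add_rels \<tau> Rs) = rels \<tau> \<union> set Rs" "add_rels \<tau> [] = \<tau>"
  "add_rels (add_rels \<tau> [R]) Rs = add_rels \<tau> (R # Rs)"
  by (auto simp: add_rels_def)

lemma map_of_zip_None: "c \<notin> set cs \<Longrightarrow> map_of (zip cs as) c = None"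
  by (auto simp: map_of_eq_None_iff dest: set_zip_leftD)

text \<open>On the left the first entry for a symbol wins, on the right the last update does; they
  coincide because \<open>c\<close> does not recur in \<open>cs\<close>.\<close>

lemma set_csts_Cons: "c \<notin> set cs \<Longrightarrow> set_csts M (c # cs) (a # as) = set_csts (set_csts M [c] [a]) cs as"
  unfolding set_csts_def
  by (rule struct.equality) (auto simp: map_of_zip_None fun_eq_iff split: option.splits)

lemma set_rels_Cons: "R \<notin> set Rs \<Longrightarrow> set_rels M (R # Rs) (V # Vs) = set_rels (set_rels M [R] [V]) Rs Vs"
  unfolding set_rels_def
  by (rule struct.equality) (auto simp: map_of_zip_None fun_eq_iff split: option.splits)

lemma finite_tuples: "finite U \<Longrightarrow> finite (tuples U k)"
  using finite_lists_length_eq[of U k] by (simp add: tuples_def conj_commute)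

lemma tuples_0 [simp]: "tuples U 0 = {[]}"
  by (auto simp: tuples_def)

lemma tuples_1: "tuples U (Suc 0) = (\<lambda>a. [a]) ` U"
  by (auto simp: tuples_def length_Suc_conv)

lemma tuples_Suc: "tuples U (Suc k) = (\<lambda>(a, as). a # as) ` (U \<times> tuples U k)"
  by (auto simp: tuples_def length_Suc_conv image_iff)

lemma rel_tuples_Nil [simp]: "rel_tuples U [] = {[]}"
  by (auto simp: rel_tuples_def)

lemma rel_tuples_Cons:
  "rel_tuples U (R # Rs) = (\<lambda>(V, Vs). V # Vs) ` (Pow (tuples U (arity R)) \<times> rel_tuples U Rs)"
  by (auto simp: rel_tuples_def list_all2_Cons1 image_iff)

lemma finite_rel_tuples: "finite U \<Longrightarrow> finite (rel_tuples U Rs)"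
  by (induction Rs) (auto simp: rel_tuples_Cons finite_tuples)

text \<open>Consing is injective, so a sum over lists of interpretations becomes an iterated sum
  that splits off the first symbol. Elements and relations are both instances.\<close>

lemma sum_filter_Cons:
  assumes "finite X" "finite Y"
  shows "(\<Sum>z\<in>{z\<in>(\<lambda>(x, y). x # y) ` (X \<times> Y). p z}. g z) = (\<Sum>x\<in>X. \<Sum>y\<in>{y\<in>Y. p (x # y)}. g (x # y))"
proof -
  have "inj_on (\<lambda>(x, y). x # y) (X \<times> Y)" by (auto intro: inj_onI)
  then show ?thesis
    using assms
    by (simp add: sum.inter_filter sum.reindex sum.cartesian_product split_def comp_def)
qed

lemma lpoly_val_SumC_Cons:
  assumes "finite (univ M)" "c \<notin> set cs"
  shows "lpoly_val M (SumC (c # cs) \<phi> p) = (\<Sum>a\<in>univ M. lpoly_val (set_csts M [c] [a]) (SumC cs \<phi> p))"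
  using assms(1) by (simp add: tuples_Suc sum_filter_Cons finite_tuples set_csts_Cons[OF assms(2)])

lemma lpoly_val_SumR_Cons:
  assumes "finite (univ M)" "R \<notin> set Rs"
  shows "lpoly_val M (SumR (R # Rs) \<phi> p) =
    (\<Sum>V\<in>Pow (tuples (univ M) (arity R)). lpoly_val (set_rels M [R] [V]) (SumR Rs \<phi> p))"
  using assms(1)
  by (simp add: rel_tuples_Cons sum_filter_Cons finite_rel_tuples finite_tuples set_rels_Cons[OF assms(2)])

lemma lpoly_val_SumC_Nil: "lpoly_val M (SumC [] \<phi> p) = (if models M \<phi> then lpoly_val M p else 0)"
  by simp

lemma lpoly_val_SumR_Nil: "lpoly_val M (SumR [] \<phi> p) = (if models M \<phi> then lpoly_val M p else 0)"
  by simp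

lemma is_lpoly_SumC_Cons:
  "is_lpoly L \<tau> (SumC (c # cs) \<phi> p) \<Longrightarrow>
    c \<notin> csts \<tau> \<and> c \<notin> set cs \<and> is_lpoly L (add_csts \<tau> [c]) (SumC cs \<phi> p)"
  by auto

lemma is_lpoly_SumR_Cons:
  "is_lpoly L \<tau> (SumR (R # Rs) \<phi> p) \<Longrightarrow>
    R \<notin> rels \<tau> \<and> R \<notin> set Rs \<and> arity R \<le> 1 \<and> is_lpoly L (add_rels \<tau> [R]) (SumR Rs \<phi> p)"
  by auto

text \<open>Lists of symbols are peeled so that an inductive step adds a single symbol. The
  condition \<open>\<phi>\<close> is then checked in the empty-list case, when all its symbols have
  been interpreted.\<close>

lemma lpoly_symbol_induct [case_names Mono SumC_Nil SumC_Cons SumR_Nil SumR_Cons]: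
  assumes "\<And>m. Q (Mono m)"
    and "\<And>\<phi> p. Q p \<Longrightarrow> Q (SumC [] \<phi> p)" and "\<And>c cs \<phi> p. Q (SumC cs \<phi> p) \<Longrightarrow> Q (SumC (c # cs) \<phi> p)"
    and "\<And>\<phi> p. Q p \<Longrightarrow> Q (SumR [] \<phi> p)" and "\<And>R Rs \<phi> p. Q (SumR Rs \<phi> p) \<Longrightarrow> Q (SumR (R # Rs) \<phi> p)"
  shows "Q P"
proof (induction P)
  case (SumC cs \<phi> p)
  then show ?case by (induction cs) (auto intro: assms)
next
  case (SumR Rs \<phi> p)
  then show ?case by (induction Rs) (auto intro: assms)
qed (rule assms)

declare lpoly_val.simps(2,3) [simp del] is_lpoly.simps(2,3) [simp del]


section \<open>Isomorphism invariance\<close>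

lemma iso_by_set_csts:
  "iso_by \<tau> f A B \<Longrightarrow> iso_by (add_csts \<tau> [c]) f (set_csts A [c] [a]) (set_csts B [c] [f a])"
  by (auto simp: iso_by_def)

lemma iso_by_set_rels:
  assumes "iso_by \<tau> f A B" "V \<subseteq> tuples (univ A) (arity R)"
  shows "iso_by (add_rels \<tau> [R]) f (set_rels A [R] [V]) (set_rels B [R] [map f ` V])"
proof -
  have "inj_on (map f) (tuples (univ A) (arity R))"
    using assms(1) bij_betw_tuples unfolding iso_by_def bij_betw_def by blast
  then show ?thesis using assms by (auto simp: iso_by_def dest: inj_onD)
qed

lemma cst_closed_set_csts: "cst_closed \<tau> A \<Longrightarrow> a \<in> univ A \<Longrightarrow> cst_closed (add_csts \<tau> [c]) (set_csts A [c] [a])"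
  by (auto simp: cst_closed_def)

lemma cst_closed_set_rels: "cst_closed \<tau> A \<Longrightarrow> cst_closed (add_rels \<tau> [R]) (set_rels A [R] [V])"
  by (auto simp: cst_closed_def)

text \<open>The factor \<open>smono_val t\<close> does not depend on the element, so a product is a
  power whose exponent counts the elements satisfying \<open>\<phi>\<close>, and \<open>f\<close>
  matches these.\<close>

lemma mono_val_iso:
  assumes "iso_by \<tau> f A B" "cst_closed \<tau> A" "is_mono L \<tau> m"
  shows "mono_val A m = mono_val B m"
  using assms(3)
proof (induction m)
  case (ProdC a \<phi> t)
  have bij: "bij_betw f (univ A) (univ B)" using assms(1) by (simp add: iso_by_def)
  have "models (set_csts A [a] [x]) \<phi> = models (set_csts B [a] [f x]) \<phi>" if "x \<in> univ A" for x
    using ProdC that assms(1,2) by (intro models_iso[OF iso_by_set_csts cst_closed_set_csts]) auto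
  then have "f ` {x \<in> univ A. models (set_csts A [a] [x]) \<phi>} = {y \<in> univ B. models (set_csts B [a] [y]) \<phi>}"
    using bij by (force simp: bij_betw_def)
  then have "bij_betw f {x \<in> univ A. models (set_csts A [a] [x]) \<phi>} {y \<in> univ B. models (set_csts B [a] [y]) \<phi>}"
    using bij by (auto simp: bij_betw_def intro: inj_on_subset)
  from bij_betw_same_card[OF this] show ?case by (simp add: prod_constant)
qed auto

text \<open>Serves to compute with sum-like operations, which are given only up to isomorphism. The
  bijection matches the ranges of summation, and it remains an isomorphism of the
  expansions.\<close>

lemma lpoly_val_iso:
  assumes "iso_by \<tau> f A B" "cst_closed \<tau> A" "finite (univ A)" "is_lpoly L \<tau> P"
  shows "lpoly_val A P = lpoly_val B P"
  using assms
proof (induction P arbitrary: \<tau> A B rule: lpoly_symbol_induct)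
  case (Mono m)
  then show ?case by (auto intro: mono_val_iso)
next
  case (SumC_Nil \<phi> p)
  then have "is_lpoly L \<tau> p" "sentence L \<tau> \<phi>" by (auto simp: is_lpoly.simps)
  then show ?case
    using SumC_Nil.IH[OF SumC_Nil.prems(1-3)] models_iso[OF SumC_Nil.prems(1,2)]
    by (simp add: lpoly_val_SumC_Nil)
next
  case (SumC_Cons c cs \<phi> p)
  note c = is_lpoly_SumC_Cons[OF SumC_Cons.prems(4)]
  have bij: "bij_betw f (univ A) (univ B)" using SumC_Cons.prems by (simp add: iso_by_def)
  have "lpoly_val (set_csts A [c] [a]) (SumC cs \<phi> p) = lpoly_val (set_csts B [c] [f a]) (SumC cs \<phi> p)"
    if "a \<in> univ A" for a
    using c SumC_Cons.prems that
    by (intro SumC_Cons.IH[of "add_csts \<tau> [c]"]) (auto intro: iso_by_set_csts cst_closed_set_csts)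
  then show ?case
    using SumC_Cons.prems c bij bij_betw_finite[OF bij]
    by (simp add: lpoly_val_SumC_Cons flip: sum.reindex_bij_betw[OF bij])
next
  case (SumR_Nil \<phi> p)
  then have "is_lpoly L \<tau> p" "sentence L \<tau> \<phi>" by (auto simp: is_lpoly.simps)
  then show ?case
    using SumR_Nil.IH[OF SumR_Nil.prems(1-3)] models_iso[OF SumR_Nil.prems(1,2)]
    by (simp add: lpoly_val_SumR_Nil)
next
  case (SumR_Cons R Rs \<phi> p)
  note R = is_lpoly_SumR_Cons[OF SumR_Cons.prems(4)]
  have bij: "bij_betw f (univ A) (univ B)" using SumR_Cons.prems by (simp add: iso_by_def)
  have bij_Pow: "bij_betw (image (map f)) (Pow (tuples (univ A) (arity R))) (Pow (tuples (univ B) (arity R)))"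
    by (rule bij_betw_Pow[OF bij_betw_tuples[OF bij]])
  have "lpoly_val (set_rels A [R] [V]) (SumR Rs \<phi> p) = lpoly_val (set_rels B [R] [map f ` V]) (SumR Rs \<phi> p)"
    if "V \<in> Pow (tuples (univ A) (arity R))" for V
    using R SumR_Cons.prems that
    by (intro SumR_Cons.IH[of "add_rels \<tau> [R]"]) (auto intro: iso_by_set_rels cst_closed_set_rels)
  then have "(\<Sum>V\<in>Pow (tuples (univ A) (arity R)). lpoly_val (set_rels A [R] [V]) (SumR Rs \<phi> p)) =
      (\<Sum>V\<in>Pow (tuples (univ A) (arity R)). lpoly_val (set_rels B [R] [map f ` V]) (SumR Rs \<phi> p))"
    by (rule sum.cong[OF refl])
  also have "\<dots> = (\<Sum>V\<in>Pow (tuples (univ B) (arity R)). lpoly_val (set_rels B [R] [V]) (SumR Rs \<phi> p))"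
    by (rule sum.reindex_bij_betw[OF bij_Pow])
  finally show ?case
    using SumR_Cons.prems R bij_betw_finite[OF bij] by (simp add: lpoly_val_SumR_Cons)
qed

text \<open>Agreement makes the identity an isomorphism.\<close>

lemma lpoly_val_agree:
  assumes "agree \<tau> A B" "cst_closed \<tau> A" "finite (univ A)" "is_lpoly L \<tau> P"
  shows "lpoly_val A P = lpoly_val B P"
  by (rule lpoly_val_iso[of \<tau> id, OF _ assms(2-4)]) (use assms(1) in \<open>auto simp: iso_by_def agree_def\<close>)

lemma models_agree: "agree \<tau> A B \<Longrightarrow> sentence L \<tau> \<phi> \<Longrightarrow> models A \<phi> = models B \<phi>"
  by (rule holds_agree) (auto simp: param_form_def Lang_def)


section \<open>Separable functions of two structures\<close>

inductive separable :: "'s set \<Rightarrow> ('s \<Rightarrow> 's \<Rightarrow> 'a::comm_semiring_1) \<Rightarrow> bool" for S where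
  product: "(\<And>A B. A \<in> S \<Longrightarrow> B \<in> S \<Longrightarrow> h A B = f A * g B) \<Longrightarrow> separable S h"
| plus: "separable S h1 \<Longrightarrow> separable S h2 \<Longrightarrow>
    (\<And>A B. A \<in> S \<Longrightarrow> B \<in> S \<Longrightarrow> h A B = h1 A B + h2 A B) \<Longrightarrow> separable S h"

lemma separable_cong:
  assumes "separable S h" "\<And>A B. A \<in> S \<Longrightarrow> B \<in> S \<Longrightarrow> h' A B = h A B"
  shows "separable S h'"
  using assms
proof (induction arbitrary: h' rule: separable.induct)
  case (product h f g)
  then show ?case by (intro separable.product[of S h' f g]) simp
next
  case (plus h1 h2 h)
  show ?case by (rule separable.plus[OF plus.hyps(1,2)]) (simp add: plus)
qed

lemma separable_const: "separable S (\<lambda>A B. k)"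
  by (rule separable.product[of _ _ "\<lambda>_. k" "\<lambda>_. 1"]) simp

lemma separable_add: "separable S h1 \<Longrightarrow> separable S h2 \<Longrightarrow> separable S (\<lambda>A B. h1 A B + h2 A B)"
  by (erule (1) separable.plus) simp

text \<open>Products of sums are expanded by distributivity, and commutativity collects the
  \<open>A\<close>-factors and the \<open>B\<close>-factors of each term.\<close>

lemma separable_mult:
  assumes "separable S h1" "separable S h2"
  shows "separable S (\<lambda>A B. h1 A B * h2 A B)"
  using assms(1)
proof (induction rule: separable.induct)
  case h1: (product h1 f g)
  show ?case
    using assms(2)
  proof (induction rule: separable.induct)
    case (product h2 f' g')
    show ?case
      by (rule separable.product[of _ _ "\<lambda>A. f A * f' A" "\<lambda>B. g B * g' B"]) (simp add: h1 product mult_ac)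
  next
    case (plus k1 k2 h2)
    show ?case by (rule separable.plus[OF plus.IH]) (simp add: plus.hyps distrib_left)
  qed
next
  case (plus k1 k2 h1)
  show ?case by (rule separable.plus[OF plus.IH]) (simp add: plus.hyps distrib_right)
qed

lemma separable_sum: "(\<And>i. i \<in> I \<Longrightarrow> separable S (h i)) \<Longrightarrow> separable S (\<lambda>A B. \<Sum>i\<in>I. h i A B)"
  by (induction I rule: infinite_finite_induct) (auto intro: separable_const separable_add)

text \<open>Split by the finitely many values \<open>z\<close> of \<open>\<beta> B\<close>: each
  piece is a function of \<open>A\<close> times the indicator of
  \<open>\<beta> B = z\<close>.\<close>

lemma separable_finite_right:
  assumes "finite F" "\<And>B. B \<in> S \<Longrightarrow> \<beta> B \<in> F"
  shows "separable S (\<lambda>A B. k A (\<beta> B))"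
proof (rule separable_cong)
  show "separable S (\<lambda>A B. \<Sum>z\<in>F. k A z * (if \<beta> B = z then 1 else 0))"
    by (rule separable_sum, rule separable.product) (rule refl)
  show "k A (\<beta> B) = (\<Sum>z\<in>F. k A z * (if \<beta> B = z then 1 else 0))" if "B \<in> S" for A B
    using assms that by (simp add: if_distrib[of "(*) _"] cong: if_cong)
qed

lemma separable_finite_left:
  assumes "finite F" "\<And>A. A \<in> S \<Longrightarrow> \<alpha> A \<in> F"
  shows "separable S (\<lambda>A B. k (\<alpha> A) B)"
proof (rule separable_cong)
  show "separable S (\<lambda>A B. \<Sum>z\<in>F. (if \<alpha> A = z then 1 else 0) * k z B)"
    by (rule separable_sum, rule separable.product) (rule refl)
  show "k (\<alpha> A) B = (\<Sum>z\<in>F. (if \<alpha> A = z then 1 else 0) * k z B)" if "A \<in> S" for A B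
    using assms that by (simp add: if_distrib[of "\<lambda>x. x * _"] cong: if_cong)
qed

text \<open>The ranges \<open>X A\<close> and \<open>Y B\<close> depend on one structure each, so
  for a product of \<open>f\<close> and \<open>g\<close> the double sum factors.\<close>

lemma separable_sum_expansions:
  assumes "separable S' h"
    and "\<And>A a. A \<in> S \<Longrightarrow> a \<in> X A \<Longrightarrow> \<alpha> A a \<in> S'" and "\<And>B b. B \<in> S \<Longrightarrow> b \<in> Y B \<Longrightarrow> \<beta> B b \<in> S'"
  shows "separable S (\<lambda>A B. \<Sum>a\<in>X A. \<Sum>b\<in>Y B. h (\<alpha> A a) (\<beta> B b))"
  using assms(1)
proof (induction rule: separable.induct)
  case (product h f g)
  show ?case
    by (rule separable.product[of _ _ "\<lambda>A. \<Sum>a\<in>X A. f (\<alpha> A a)" "\<lambda>B. \<Sum>b\<in>Y B. g (\<beta> B b)"])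
      (simp add: product assms sum_product)
next
  case (plus h1 h2 h)
  show ?case by (rule separable.plus[OF plus.IH]) (simp add: plus.hyps assms sum.distrib)
qed

section \<open>Finite rank of the matrices of separable functions\<close>

lemma vector_space_pointwise: "vector_space (\<lambda>(c::'k::field) v (j::'j). c * v j)"
  by unfold_locales (auto simp: fun_eq_iff algebra_simps)

text \<open>For a product, every row is the scalar \<open>f A\<close> times one vector
  \<open>g\<close>, cut off outside \<open>S\<close> to match \<open>matrix_row\<close>. For a sum,
  the spanning sets are united.\<close>

lemma separable_rows_span:
  fixes h :: "'s \<Rightarrow> 's \<Rightarrow> 'a::idom"
  assumes "separable S h"
  shows "\<exists>T. finite T \<and> matrix_row S (\<lambda>A B. Fract (h A B) 1) ` S \<subseteq> module.span (\<lambda>c v j. c * v j) T"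
proof -
  interpret vector_space "\<lambda>(c::'a fract) v (j::'s). c * v j" by (rule vector_space_pointwise)
  show ?thesis
    using assms
  proof (induction rule: separable.induct)
    case (product h f g)
    let ?v = "\<lambda>B. if B \<in> S then Fract (g B) 1 else 0"
    have "matrix_row S (\<lambda>A B. Fract (h A B) 1) A = (\<lambda>j. Fract (f A) 1 * ?v j)" if "A \<in> S" for A
      using product that by (auto simp: matrix_row_def fun_eq_iff)
    then have "matrix_row S (\<lambda>A B. Fract (h A B) 1) ` S \<subseteq> span {?v}"
      using span_scale[OF span_base[of ?v "{?v}"]] by auto
    then show ?case by blast
  next
    case (plus h1 h2 h)
    then obtain T1 T2 where T: "finite T1" "finite T2"
      "matrix_row S (\<lambda>A B. Fract (h1 A B) 1) ` S \<subseteq> span T1"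
      "matrix_row S (\<lambda>A B. Fract (h2 A B) 1) ` S \<subseteq> span T2" by auto
    have "matrix_row S (\<lambda>A B. Fract (h A B) 1) A \<in> span (T1 \<union> T2)" if "A \<in> S" for A
    proof -
      have "matrix_row S (\<lambda>A B. Fract (h A B) 1) A =
          matrix_row S (\<lambda>A B. Fract (h1 A B) 1) A + matrix_row S (\<lambda>A B. Fract (h2 A B) 1) A"
        using plus.hyps(3) that by (auto simp: matrix_row_def fun_eq_iff)
      moreover have "matrix_row S (\<lambda>A B. Fract (h1 A B) 1) A \<in> span (T1 \<union> T2)"
        "matrix_row S (\<lambda>A B. Fract (h2 A B) 1) A \<in> span (T1 \<union> T2)"
        using T(3,4) that span_mono[of T1 "T1 \<union> T2"] span_mono[of T2 "T1 \<union> T2"] by blast+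
      ultimately show ?thesis by (simp add: span_add)
    qed
    then show ?case using T(1,2) by (intro exI[of _ "T1 \<union> T2"]) auto
  qed
qed

text \<open>An independent set inside the span of \<open>T\<close> has at most \<open>card T\<close>
  elements, which bounds every term of the supremum.\<close>

lemma matrix_rank_separable:
  fixes h :: "'s \<Rightarrow> 's \<Rightarrow> 'a::idom"
  assumes "separable S h"
  shows "matrix_rank S S (\<lambda>A B. Fract (h A B) 1) < \<infinity>"
proof -
  interpret vector_space "\<lambda>(c::'a fract) v (j::'s). c * v j" by (rule vector_space_pointwise)
  obtain T where T: "finite T" "matrix_row S (\<lambda>A B. Fract (h A B) 1) ` S \<subseteq> span T"
    using separable_rows_span[OF assms] by auto
  have "matrix_rank S S (\<lambda>A B. Fract (h A B) 1) \<le> enat (card T)"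
    unfolding matrix_rank_def lin_dependent_def
  proof (rule SUP_least)
    fix R assume "R \<in> {R. R \<subseteq> matrix_row S (\<lambda>A B. Fract (h A B) 1) ` S \<and> finite R \<and> independent R}"
    then have "independent R" "R \<subseteq> span T" using T(2) by auto
    then show "enat (card R) \<le> enat (card T)" using independent_span_bound[OF T(1)] by simp
  qed
  also have "\<dots> < \<infinity>" by simp
  finally show ?thesis .
qed


section \<open>Expansions of rich disjoint unions\<close>

lemma over_mono: "over \<tau> \<phi> \<Longrightarrow> rels \<tau> \<subseteq> rels \<tau>' \<Longrightarrow> csts \<tau> \<subseteq> csts \<tau>' \<Longrightarrow> over \<tau>' \<phi>"
proof -
  assume sub: "rels \<tau> \<subseteq> rels \<tau>'" "csts \<tau> \<subseteq> csts \<tau>'"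
  have "tm_over \<tau> t \<Longrightarrow> tm_over \<tau>' t" for t using sub by (cases t) auto
  then show "over \<tau> \<phi> \<Longrightarrow> over \<tau>' \<phi>" using sub by (induction \<phi>) auto
qed

lemma param_form_mono:
  "param_form L \<tau> k \<phi> \<Longrightarrow> rels \<tau> \<subseteq> rels \<tau>' \<Longrightarrow> csts \<tau> \<subseteq> csts \<tau>' \<Longrightarrow> param_form L \<tau>' k \<phi>"
  by (auto simp: param_form_def Lang_def intro: over_mono)

lemma rich_vocab_sel [simp]:
  "rels (rich_vocab \<tau>) = RIn ` rels \<tau> \<union> {PLeft, PRight}"
  "csts (rich_vocab \<tau>) = CLeft ` csts \<tau> \<union> CRight ` csts \<tau>"
  by (auto simp: rich_vocab_def)

lemma rich_union_sel [simp]: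
  "univ (rich_union A B) = inl ` univ A \<union> inr ` univ B"
  "rel (rich_union A B) = rich_rel A B" "cst (rich_union A B) = rich_cst A B"
  by (auto simp: rich_union_def)

lemma vocabulary_rich: "vocabulary \<tau> \<Longrightarrow> vocabulary (rich_vocab \<tau>)"
  by (simp add: vocabulary_def)

lemma vocabulary_add: "vocabulary \<tau> \<Longrightarrow> vocabulary (add_csts \<tau> cs)" "vocabulary \<tau> \<Longrightarrow> vocabulary (add_rels \<tau> Rs)"
  by (simp_all add: vocabulary_def)

lemma Str_set_csts: "A \<in> Str \<tau> \<Longrightarrow> a \<in> univ A \<Longrightarrow> set_csts A [c] [a] \<in> Str (add_csts \<tau> [c])"
  by (auto simp: Str_def)

lemma Str_set_rels:
  "A \<in> Str \<tau> \<Longrightarrow> V \<subseteq> tuples (univ A) (arity R) \<Longrightarrow> set_rels A [R] [V] \<in> Str (add_rels \<tau> [R])"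
  by (auto simp: Str_def)

lemma finite_univ_star: "A \<in> Str \<tau> \<Longrightarrow> B \<in> Str \<tau> \<Longrightarrow> finite (univ (star \<Phi> (rich_union A B)))"
  by (auto simp: Str_def univ_star)

section \<open>Expanding both components, and the transduction, by one new symbol\<close>

lemma agree_rich_set_csts:
  "c \<notin> csts \<tau> \<Longrightarrow>
    agree (rich_vocab \<tau>) (rich_union (set_csts A [c] [x]) (set_csts B [c] [y])) (rich_union A B)"
  by (auto simp: agree_def)

lemma agree_rich_set_rels:
  "R \<notin> rels \<tau> \<Longrightarrow>
    agree (rich_vocab \<tau>) (rich_union (set_rels A [R] [V]) (set_rels B [R] [W])) (rich_union A B)"
  by (auto simp: agree_def)

text \<open>The symbol \<open>d\<close> will be \<open>CLeft c\<close> or \<open>CRight c\<close>,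
  and so fixes the part in which the new element is found; the other copy then names the
  dummy.\<close>

definition transd_cst :: "transd \<Rightarrow> csym \<Rightarrow> csym \<Rightarrow> transd" where
  "transd_cst \<Phi> c d = \<Phi>\<lparr>t_cst := (t_cst \<Phi>)(c := d)\<rparr>"

text \<open>In a rich union \<open>RIn R\<close> denotes the union of the tagged relations of both
  parts, so the new relation is assembled from one relation on each side.\<close>

definition transd_rel :: "transd \<Rightarrow> rsym \<Rightarrow> transd" where
  "transd_rel \<Phi> R = \<Phi>\<lparr>t_rel := (t_rel \<Phi>)(R := Rel (RIn R) (map Var [0..<arity R]))\<rparr>"

lemma transduction_transd_cst:
  assumes "transduction L (rich_vocab \<tau>) \<tau> \<Phi>" "d \<in> {CLeft c, CRight c}"
  shows "transduction L (rich_vocab (add_csts \<tau> [c])) (add_csts \<tau> [c]) (transd_cst \<Phi> c d)"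
proof -
  have "param_form L (rich_vocab \<tau>) k \<phi> \<Longrightarrow> param_form L (rich_vocab (add_csts \<tau> [c])) k \<phi>" for k \<phi>
    by (erule param_form_mono) auto
  then show ?thesis using assms by (auto simp: transduction_def transd_cst_def)
qed

text \<open>The formulas of \<open>\<Phi>\<close> are over \<open>rich_vocab \<tau>\<close>, which
  contains neither copy of the fresh symbol \<open>c\<close>. The universe and the old symbols are
  thus unaffected by the expansions, and only \<open>c\<close> receives a new value.\<close>

lemma agree_star_transd_cst:
  assumes "transduction L (rich_vocab \<tau>) \<tau> \<Phi>" "c \<notin> csts \<tau>"
  defines "C \<equiv> \<lambda>A B x y. rich_union (set_csts A [c] [x]) (set_csts B [c] [y])"
  shows "agree (add_csts \<tau> [c]) (star (transd_cst \<Phi> c d) (C A B x y))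
    (set_csts (star \<Phi> (rich_union A B)) [c] [cst (C A B x y) d])"
proof -
  have "agree \<tau> (star \<Phi> (C A B x y)) (star \<Phi> (rich_union A B))"
    unfolding C_def by (rule agree_star[OF agree_rich_set_csts[OF assms(2)] assms(1)])
  moreover have "univ (star (transd_cst \<Phi> c d) (C A B x y)) = univ (star \<Phi> (C A B x y))"
    "rel (star (transd_cst \<Phi> c d) (C A B x y)) = rel (star \<Phi> (C A B x y))"
    "cst (star (transd_cst \<Phi> c d) (C A B x y)) = (cst (star \<Phi> (C A B x y)))(c := cst (C A B x y) d)"
    by (auto simp: univ_star rel_star cst_star transd_cst_def fun_eq_iff)
  ultimately show ?thesis by (auto simp: agree_def)
qed

lemma holds_Rel_RIn: "length as = arity R \<Longrightarrow> holds C (Rel (RIn R) (map Var [0..<arity R])) as \<longleftrightarrow> as \<in> rel C (RIn R)"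
  using map_nth[of as] by (simp add: holds_def comp_def)

text \<open>The containment is assumed because \<open>star\<close> cuts every relation down to
  tuples over its own universe.\<close>

lemma agree_star_transd_rel:
  assumes "transduction L (rich_vocab \<tau>) \<tau> \<Phi>" "R \<notin> rels \<tau>"
    and "map inl ` V \<union> map inr ` W \<subseteq> tuples (univ (star \<Phi> (rich_union A B))) (arity R)"
  shows "agree (add_rels \<tau> [R])
    (star (transd_rel \<Phi> R) (rich_union (set_rels A [R] [V]) (set_rels B [R] [W])))
    (set_rels (star \<Phi> (rich_union A B)) [R] [map inl ` V \<union> map inr ` W])"
proof -
  let ?C = "rich_union (set_rels A [R] [V]) (set_rels B [R] [W])"
  let ?M = "star \<Phi> ?C"
  have agr: "agree \<tau> ?M (star \<Phi> (rich_union A B))"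
    by (rule agree_star[OF agree_rich_set_rels[OF assms(2)] assms(1)])
  have univ: "univ (star (transd_rel \<Phi> R) ?C) = univ ?M"
    by (simp add: univ_star transd_rel_def)
  moreover have "rel (star (transd_rel \<Phi> R) ?C) R' = rel ?M R'" if "R' \<noteq> R" for R'
    unfolding rel_star univ using that by (simp add: transd_rel_def)
  moreover have "rel (star (transd_rel \<Phi> R) ?C) R = map inl ` V \<union> map inr ` W"
  proof -
    have "rel (star (transd_rel \<Phi> R) ?C) R = {as \<in> tuples (univ ?M) (arity R). as \<in> rel ?C (RIn R)}"
      unfolding rel_star univ by (auto simp: transd_rel_def holds_Rel_RIn tuples_def)
    then show ?thesis using assms(3) agr by (auto simp: agree_def)
  qed
  moreover have "cst (star (transd_rel \<Phi> R) ?C) = cst ?M"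
    by (auto simp: cst_star transd_rel_def)
  ultimately show ?thesis using agr by (auto simp: agree_def)
qed

context tame_fragment
begin

lemma transduction_transd_rel:
  assumes "vocabulary \<tau>" "transduction L (rich_vocab \<tau>) \<tau> \<Phi>"
  shows "transduction L (rich_vocab (add_rels \<tau> [R])) (add_rels \<tau> [R]) (transd_rel \<Phi> R)"
proof -
  let ?\<tau> = "rich_vocab (add_rels \<tau> [R])" and ?\<phi> = "Rel (RIn R) (map Var [0..<arity R])"
  have "param_form L (rich_vocab \<tau>) k \<phi> \<Longrightarrow> param_form L ?\<tau> k \<phi>" for k \<phi>
    by (erule param_form_mono) auto
  moreover have "param_form L ?\<tau> (arity R) ?\<phi>"
    using Rel_closed[OF vocabulary_rich[OF vocabulary_add(2)[OF assms(1)]], of "[R]" "RIn R"]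
    by (auto simp: param_form_def Lang_def)
  ultimately show ?thesis using assms(2) by (auto simp: transduction_def transd_rel_def)
qed

text \<open>
  Fragments need not be closed under substituting a constant into a formula, so membership of an
  expansion in the universe of the transduced structure is expressed by a guarded quantifier.
\<close>

lemma sentence_guarded:
  assumes "vocabulary \<tau>" "\<phi> \<in> Lang L \<tau>" "fv \<phi> \<subseteq> {0}" "frv \<phi> = {}" "param_form L \<tau> 1 \<psi>"
  shows "sentence L \<tau> (All 0 (Imp \<phi> \<psi>))"
  using assms(2-) All_Imp_closed[OF assms(1,2), of \<psi>] by (auto simp: param_form_def Lang_def)

lemma models_guarded:
  assumes "param_form L \<tau> 1 \<psi>"
  shows "models C (All 0 (Imp \<phi> \<psi>)) \<longleftrightarrow>
    (\<forall>a\<in>univ C. sat C (((!) [])(0 := a)) (\<lambda>_. {}) \<phi> \<longrightarrow> holds C \<psi> [a])"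
proof -
  have "sat C (((!) [])(0 := a)) (\<lambda>_. {}) \<psi> = holds C \<psi> [a]" for a
    unfolding holds_def by (rule sat_cong) (use assms in \<open>auto simp: param_form_def\<close>)
  then show ?thesis by (auto simp: holds_def)
qed

definition guard_cst :: "transd \<Rightarrow> csym \<Rightarrow> form" where
  "guard_cst \<Phi> d = All 0 (Imp (Eq (Var 0) (Const d)) (t_univ \<Phi>))"

definition guard_rel :: "transd \<Rightarrow> rsym \<Rightarrow> form" where
  "guard_rel \<Phi> R = All 0 (Imp (Rel R [Var 0]) (t_univ \<Phi>))"

lemma sentence_guard_cst:
  assumes "vocabulary \<tau>" "transduction L (rich_vocab \<tau>) \<tau> \<Phi>" "d \<in> {CLeft c, CRight c}"
  shows "sentence L (rich_vocab (add_csts \<tau> [c])) (guard_cst \<Phi> d)"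
  unfolding guard_cst_def
proof (rule sentence_guarded)
  show voc: "vocabulary (rich_vocab (add_csts \<tau> [c]))" by (intro vocabulary_rich vocabulary_add assms)
  show "Eq (Var 0) (Const d) \<in> Lang L (rich_vocab (add_csts \<tau> [c]))"
    using Eq_closed[OF voc, of "Var 0" "Const d"] assms(3) by (auto simp: Lang_def)
  show "param_form L (rich_vocab (add_csts \<tau> [c])) 1 (t_univ \<Phi>)"
    using assms(2) by (auto simp: transduction_def elim!: param_form_mono)
qed auto

lemma models_guard_cst:
  assumes "transduction L (rich_vocab \<tau>) \<tau> \<Phi>" "d \<in> {CLeft c, CRight c}" "c \<notin> csts \<tau>"
    and "x \<in> univ A" "y \<in> univ B"
  defines "C \<equiv> rich_union (set_csts A [c] [x]) (set_csts B [c] [y])"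
  shows "models C (guard_cst \<Phi> d) \<longleftrightarrow> cst C d \<in> univ (star \<Phi> (rich_union A B))"
proof -
  have \<Phi>: "param_form L (rich_vocab \<tau>) 1 (t_univ \<Phi>)" using assms(1) by (simp add: transduction_def)
  \<comment> \<open>The guard quantifies over \<open>univ C\<close> and would hold vacuously if the
    named element were not there.\<close>
  have "cst C d \<in> univ C" using assms(2,4,5) by (auto simp: C_def)
  then have "models C (guard_cst \<Phi> d) \<longleftrightarrow> cst C d \<in> univ C \<and> holds C (t_univ \<Phi>) [cst C d]"
    unfolding guard_cst_def models_guarded[OF \<Phi>] by auto
  also have "\<dots> \<longleftrightarrow> cst C d \<in> univ (star \<Phi> C)" by (simp add: univ_star)
  also have "univ (star \<Phi> C) = univ (star \<Phi> (rich_union A B))"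
    using agree_star[OF agree_rich_set_csts[OF assms(3)] assms(1)] by (simp add: agree_def C_def)
  finally show ?thesis .
qed

lemma sentence_guard_rel:
  assumes "vocabulary \<tau>" "transduction L (rich_vocab \<tau>) \<tau> \<Phi>" "arity R = 1"
  shows "sentence L (rich_vocab (add_rels \<tau> [R])) (guard_rel \<Phi> (RIn R))"
  unfolding guard_rel_def
proof (rule sentence_guarded)
  show voc: "vocabulary (rich_vocab (add_rels \<tau> [R]))" by (intro vocabulary_rich vocabulary_add assms)
  show "Rel (RIn R) [Var 0] \<in> Lang L (rich_vocab (add_rels \<tau> [R]))"
    using Rel_closed[OF voc, of "RIn R" "[Var 0]"] assms(3) by (auto simp: Lang_def)
  show "param_form L (rich_vocab (add_rels \<tau> [R])) 1 (t_univ \<Phi>)"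
    using assms(2) by (auto simp: transduction_def elim!: param_form_mono)
qed auto

lemma models_guard_rel:
  assumes "transduction L (rich_vocab \<tau>) \<tau> \<Phi>" "R \<notin> rels \<tau>" "arity R = 1"
    and "V \<subseteq> tuples (univ A) (arity R)" "W \<subseteq> tuples (univ B) (arity R)"
  defines "C \<equiv> rich_union (set_rels A [R] [V]) (set_rels B [R] [W])"
  shows "models C (guard_rel \<Phi> (RIn R)) \<longleftrightarrow>
    map inl ` V \<union> map inr ` W \<subseteq> tuples (univ (star \<Phi> (rich_union A B))) (arity R)"
proof -
  have \<Phi>: "param_form L (rich_vocab \<tau>) 1 (t_univ \<Phi>)" using assms(1) by (simp add: transduction_def)
  let ?Z = "map inl ` V \<union> map inr ` W"
  \<comment> \<open>Arity one makes every tuple a single element, so one first-order quantifier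
    controls the whole relation.\<close>
  have Z: "?Z \<subseteq> (\<lambda>a. [a]) ` univ C"
    using assms(3-5) by (fastforce simp: C_def tuples_1)
  have "models C (guard_rel \<Phi> (RIn R)) \<longleftrightarrow> (\<forall>a\<in>univ C. [a] \<in> ?Z \<longrightarrow> holds C (t_univ \<Phi>) [a])"
    unfolding guard_rel_def models_guarded[OF \<Phi>] by (simp add: C_def)
  also have "\<dots> \<longleftrightarrow> ?Z \<subseteq> tuples (univ (star \<Phi> C)) (arity R)"
  proof -
    have "(\<forall>a\<in>U. [a] \<in> Z \<longrightarrow> p a) \<longleftrightarrow> Z \<subseteq> (\<lambda>a. [a]) ` {a\<in>U. p a}" if "Z \<subseteq> (\<lambda>a. [a]) ` U"
      for Z U and p :: "nat \<Rightarrow> bool"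
      using that by auto
    from this[OF Z] show ?thesis by (simp only: assms(3) One_nat_def tuples_1 univ_star)
  qed
  also have "univ (star \<Phi> C) = univ (star \<Phi> (rich_union A B))"
    using agree_star[OF agree_rich_set_rels[OF assms(2)] assms(1)] by (simp add: agree_def C_def)
  finally show ?thesis .
qed

end


section \<open>Separability of definable polynomials\<close>

lemma sum_split_images:
  assumes "finite X" "finite Y" "inj_on i X" "inj_on j Y" "i ` X \<inter> j ` Y = {}" "T \<subseteq> i ` X \<union> j ` Y"
  shows "(\<Sum>a\<in>T. g a) = (\<Sum>x\<in>X. if i x \<in> T then g (i x) else 0) + (\<Sum>y\<in>Y. if j y \<in> T then g (j y) else 0)"
proof -
  have "(\<Sum>a\<in>T. g a) = (\<Sum>a\<in>i ` X \<union> j ` Y. if a \<in> T then g a else 0)"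
    using assms by (intro sum.mono_neutral_cong_left) auto
  also have "\<dots> = (\<Sum>a\<in>i ` X. if a \<in> T then g a else 0) + (\<Sum>a\<in>j ` Y. if a \<in> T then g a else 0)"
    using assms by (intro sum.union_disjoint) auto
  finally show ?thesis using assms by (simp add: sum.reindex)
qed

text \<open>Subsets of a disjoint union correspond to pairs of subsets. The pairs range over all
  subsets of \<open>X\<close> and \<open>Y\<close>, independently of \<open>T\<close>, so that in
  the application each range depends on one structure only; pairs leaving \<open>T\<close> are
  padded with \<open>0\<close>.\<close>

lemma sum_Pow_split_images:
  assumes "finite X" "finite Y" "inj_on i X" "inj_on j Y" "i ` X \<inter> j ` Y = {}" "T \<subseteq> i ` X \<union> j ` Y"
  shows "(\<Sum>Z\<in>Pow T. g Z) = (\<Sum>V\<in>Pow X. \<Sum>W\<in>Pow Y. if i ` V \<union> j ` W \<subseteq> T then g (i ` V \<union> j ` W) else 0)"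
proof -
  let ?f = "\<lambda>p. i ` fst p \<union> j ` snd p"
  have inj: "inj_on ?f (Pow X \<times> Pow Y)"
  proof (rule inj_onI, clarsimp)
    fix V W V' W'
    assume sub: "V \<subseteq> X" "W \<subseteq> Y" "V' \<subseteq> X" "W' \<subseteq> Y" and eq: "i ` V \<union> j ` W = i ` V' \<union> j ` W'"
    have "i ` V = i ` V'" "j ` W = j ` W'" using eq sub assms(5) by blast+
    then show "V = V' \<and> W = W'"
      using sub assms(3,4) by (simp add: inj_on_image_eq_iff)
  qed
  have img: "?f ` (Pow X \<times> Pow Y) = Pow (i ` X \<union> j ` Y)"
  proof
    show "Pow (i ` X \<union> j ` Y) \<subseteq> ?f ` (Pow X \<times> Pow Y)"
    proof
      fix Z assume "Z \<in> Pow (i ` X \<union> j ` Y)"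
      then have "Z = ?f ({x\<in>X. i x \<in> Z}, {y\<in>Y. j y \<in> Z})" by auto
      then show "Z \<in> ?f ` (Pow X \<times> Pow Y)" by blast
    qed
  qed auto
  have "(\<Sum>Z\<in>Pow T. g Z) = (\<Sum>Z\<in>Pow (i ` X \<union> j ` Y). if Z \<subseteq> T then g Z else 0)"
    using assms by (intro sum.mono_neutral_cong_left) auto
  also have "\<dots> = (\<Sum>p\<in>Pow X \<times> Pow Y. if ?f p \<subseteq> T then g (?f p) else 0)"
    unfolding img[symmetric] by (subst sum.reindex[OF inj]) (simp add: comp_def)
  finally show ?thesis by (simp add: sum.cartesian_product split_def)
qed

lemma inj_inl: "inj_on inl X" and inj_inr: "inj_on inr X"
  by (simp_all add: inj_on_def sum_encode_eq)

lemma inl_neq_inr: "inl a \<noteq> inr b"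
  by (simp add: sum_encode_eq)

lemma sum_star_univ:
  assumes "A \<in> Str \<tau>" "B \<in> Str \<tau>" and "U = univ (star \<Phi> (rich_union A B))"
  shows "(\<Sum>a\<in>U. g a) = (\<Sum>x\<in>univ A. if inl x \<in> U then g (inl x) else 0) +
    (\<Sum>y\<in>univ B. if inr y \<in> U then g (inr y) else 0)"
  using assms by (intro sum_split_images inj_inl inj_inr) (auto simp: Str_def univ_star inl_neq_inr)

section \<open>Types of bounded quantifier rank\<close>

locale smooth_fragment = tame_fragment +
  assumes rich_union_smooth: "rich_union_smooth L qr"
begin

text \<open>\<open>T A\<close> encodes the type of \<open>A\<close> up to rank
  \<open>qr \<psi>\<close> by the true ones among finitely many representatives. By smoothness,
  equal types of both components give unions agreeing on \<open>\<psi>\<close>, so its truth value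
  factors through pairs of types.\<close>

lemma finite_types:
  assumes "vocabulary \<tau>" "sentence L (rich_vocab \<tau>) \<psi>"
  shows "\<exists>(T :: struct \<Rightarrow> form set) F Q. finite F \<and> (\<forall>A\<in>Str \<tau>. T A \<in> F) \<and>
    (\<forall>A\<in>Str \<tau>. \<forall>B\<in>Str \<tau>. models (rich_union A B) \<psi> \<longleftrightarrow> Q (T A) (T B))"
proof -
  obtain F where F: "finite F"
    "\<And>\<phi>. \<phi> \<in> Lang L \<tau> \<Longrightarrow> qr \<phi> \<le> qr \<psi> \<Longrightarrow> fv \<phi> = {} \<Longrightarrow> frv \<phi> = {} \<Longrightarrow> \<exists>\<psi>\<in>F. equivalent \<tau> \<phi> \<psi>"
    using finitely_many[OF assms(1), of "{}" "{}" "qr \<psi>"] by auto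
  \<comment> \<open>The representatives need not be sentences, and \<open>equivalent\<close> speaks
    only of assignments into the universe. So they are evaluated at a constant assignment to a
    chosen element, with empty relations, rather than by \<open>models\<close>.\<close>
  define T where "T A = {\<chi>\<in>F. sat A (\<lambda>_. SOME a. a \<in> univ A) (\<lambda>_. {}) \<chi>}" for A
  have equiv: "q_equiv L qr \<tau> (qr \<psi>) A B" if "A \<in> Str \<tau>" "B \<in> Str \<tau>" "T A = T B" for A B
    unfolding q_equiv_def
  proof (intro allI impI)
    fix \<phi> assume \<phi>: "sentence L \<tau> \<phi> \<and> qr \<phi> \<le> qr \<psi>"
    then obtain \<chi> where \<chi>: "\<chi> \<in> F" "equivalent \<tau> \<phi> \<chi>"
      using F(2)[of \<phi>] by (auto simp: param_form_def)
    have "models D \<phi> \<longleftrightarrow> \<chi> \<in> T D" if "D \<in> Str \<tau>" for D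
    proof -
      have "univ D \<noteq> {}" using that by (simp add: Str_def)
      then have "(SOME a. a \<in> univ D) \<in> univ D" by (simp add: some_in_eq)
      then have "sat D (\<lambda>_. SOME a. a \<in> univ D) (\<lambda>_. {}) \<phi> = sat D (\<lambda>_. SOME a. a \<in> univ D) (\<lambda>_. {}) \<chi>"
        using \<chi>(2) that by (simp add: equivalent_def image_subset_iff)
      moreover have "models D \<phi> = sat D (\<lambda>_. SOME a. a \<in> univ D) (\<lambda>_. {}) \<phi>"
        unfolding holds_def by (rule sat_cong) (use \<phi> in \<open>auto simp: param_form_def\<close>)
      ultimately show ?thesis using \<chi>(1) by (simp add: T_def)
    qed
    then show "models A \<phi> = models B \<phi>" using that by simp
  qed
  \<comment> \<open>\<open>Q\<close> is defined through some witnessing pair of structures;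
    smoothness makes it independent of the pair.\<close>
  define Q where "Q t u \<longleftrightarrow> (\<exists>A\<in>Str \<tau>. \<exists>B\<in>Str \<tau>. t = T A \<and> u = T B \<and> models (rich_union A B) \<psi>)" for t u
  have "models (rich_union A B) \<psi> \<longleftrightarrow> Q (T A) (T B)" if AB: "A \<in> Str \<tau>" "B \<in> Str \<tau>" for A B
  proof
    show "models (rich_union A B) \<psi> \<Longrightarrow> Q (T A) (T B)" using AB by (auto simp: Q_def)
    assume "Q (T A) (T B)"
    then obtain A' B' where "A' \<in> Str \<tau>" "B' \<in> Str \<tau>" "T A = T A'" "T B = T B'" "models (rich_union A' B') \<psi>"
      by (auto simp: Q_def)
    then have "q_equiv L qr (rich_vocab \<tau>) (qr \<psi>) (rich_union A' B') (rich_union A B)"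
      using rich_union_smooth assms(1) AB equiv[of A' A] equiv[of B' B]
      unfolding rich_union_smooth_def smooth_def by metis
    then show "models (rich_union A B) \<psi>"
      using assms(2) \<open>models (rich_union A' B') \<psi>\<close> by (auto simp: q_equiv_def)
  qed
  moreover have "\<forall>A\<in>Str \<tau>. T A \<in> Pow F" by (auto simp: T_def)
  ultimately show ?thesis using F(1) by blast
qed

lemma separable_indicator:
  assumes "vocabulary \<tau>" "sentence L (rich_vocab \<tau>) \<psi>"
  shows "separable (Str \<tau>) (\<lambda>A B. if models (rich_union A B) \<psi> then 1 else 0)"
proof -
  obtain T :: "struct \<Rightarrow> form set" and F Q where T: "finite F" "\<And>A. A \<in> Str \<tau> \<Longrightarrow> T A \<in> F"
    "\<And>A B. A \<in> Str \<tau> \<Longrightarrow> B \<in> Str \<tau> \<Longrightarrow> models (rich_union A B) \<psi> \<longleftrightarrow> Q (T A) (T B)"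
    using finite_types[OF assms] by metis
  have "separable (Str \<tau>) (\<lambda>A B. if Q (T A) (T B) then 1 else 0)"
    using T(1,2) by (rule separable_finite_right)
  then show ?thesis by (rule separable_cong) (simp add: T(3))
qed

text \<open>Values are prescribed only where the constants of the transduced structure lie in its
  universe, as truth transfer along \<open>sharp\<close> asks for. An expansion by a new element
  violates this when the element falls outside the universe; a guard takes care of that
  case.\<close>

definition star_separable :: "vocab \<Rightarrow> transd \<Rightarrow> (struct \<Rightarrow> 'a::comm_semiring_1) \<Rightarrow> bool" where
  "star_separable \<tau> \<Phi> v \<longleftrightarrow> (\<exists>h. separable (Str \<tau>) h \<and>
     (\<forall>A\<in>Str \<tau>. \<forall>B\<in>Str \<tau>. cst_closed \<tau> (star \<Phi> (rich_union A B)) \<longrightarrow> v (star \<Phi> (rich_union A B)) = h A B))"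

section \<open>Separability over a transduced rich union: conditions, products and sums\<close>

lemma star_separable_indicator:
  assumes "vocabulary \<tau>" "transduction L (rich_vocab \<tau>) \<tau> \<Phi>" "sentence L \<tau> \<phi>" "star_separable \<tau> \<Phi> v"
  shows "star_separable \<tau> \<Phi> (\<lambda>M. if models M \<phi> then v M else 0)"
proof -
  obtain h where h: "separable (Str \<tau>) h" "\<And>A B. A \<in> Str \<tau> \<Longrightarrow> B \<in> Str \<tau> \<Longrightarrow>
      cst_closed \<tau> (star \<Phi> (rich_union A B)) \<Longrightarrow> v (star \<Phi> (rich_union A B)) = h A B"
    using assms(4) unfolding star_separable_def by blast
  \<comment> \<open>Tameness makes the backward translation a sentence of the fragment, so the
    condition becomes a separable indicator.\<close>
  have "separable (Str \<tau>) (\<lambda>A B. (if models (rich_union A B) (sharp \<Phi> \<phi>) then 1 else 0) * h A B)"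
    by (intro separable_mult separable_indicator h sentence_sharp[OF _ _ assms(2)] vocabulary_rich assms)
  then show ?thesis
    unfolding star_separable_def
    by (intro exI conjI, assumption) (simp add: h models_sharp[OF assms(2) _ assms(3)])
qed

text \<open>The product is a power whose exponent is the number of solutions in the left part plus
  that in the right part. The left count is a function of \<open>A\<close> and of the type of
  \<open>B\<close> expanded by its dummy. As there are finitely many types, each of the two powers
  is separable, although the exponents are unbounded.\<close>

lemma star_separable_ProdC:
  assumes "vocabulary \<tau>" "transduction L (rich_vocab \<tau>) \<tau> \<Phi>" "is_mono L \<tau> (ProdC c \<phi> t)"
  shows "star_separable \<tau> \<Phi> (\<lambda>M. mono_val M (ProdC c \<phi> t))"
proof -
  let ?\<tau> = "add_csts \<tau> [c]"
  define d where "d A = (SOME a. a \<in> univ A)" for A :: struct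
  have d: "d A \<in> univ A" if "A \<in> Str \<tau>" for A using that by (auto simp: d_def Str_def some_in_eq)
  define \<psi> where "\<psi> b = Conj (guard_cst \<Phi> b) (sharp (transd_cst \<Phi> c b) \<phi>)" for b
  have c: "c \<notin> csts \<tau>" and \<phi>: "sentence L ?\<tau> \<phi>" using assms(3) by auto
  have voc: "vocabulary ?\<tau>" "vocabulary (rich_vocab ?\<tau>)"
    by (intro vocabulary_add vocabulary_rich assms)+
  have \<psi>: "sentence L (rich_vocab ?\<tau>) (\<psi> b)" if "b \<in> {CLeft c, CRight c}" for b
    using sentence_guard_cst[OF assms(1,2) that] Conj_closed[OF voc(2)]
      sentence_sharp[OF voc(2,1) transduction_transd_cst[OF assms(2) that] \<phi>]
    by (auto simp: param_form_def Lang_def \<psi>_def)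
  have models_\<psi>: "models C (\<psi> b) \<longleftrightarrow> cst C b \<in> univ M \<and> models (set_csts M [c] [cst C b]) \<phi>"
    if "b \<in> {CLeft c, CRight c}" "A \<in> Str \<tau>" "B \<in> Str \<tau>" "x \<in> univ A" "y \<in> univ B"
      and "M = star \<Phi> (rich_union A B)" "cst_closed \<tau> M"
      and C: "C = rich_union (set_csts A [c] [x]) (set_csts B [c] [y])" for b A B x y M C
  proof (cases "cst C b \<in> univ M")
    case True
    have agr: "agree ?\<tau> (star (transd_cst \<Phi> c b) C) (set_csts M [c] [cst C b])"
      unfolding that by (rule agree_star_transd_cst[OF assms(2) c])
    moreover have "cst_closed ?\<tau> (set_csts M [c] [cst C b])"
      using that(7) True by (rule cst_closed_set_csts)
    ultimately have "cst_closed ?\<tau> (star (transd_cst \<Phi> c b) C)" by (simp add: cst_closed_def agree_def)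
    then show ?thesis
      using True models_guard_cst[OF assms(2) that(1) c that(4,5)]
        models_sharp[OF transduction_transd_cst[OF assms(2) that(1)] _ \<phi>] models_agree[OF agr \<phi>] that(6) C
      by (simp add: \<psi>_def holds_def)
  next
    case False
    then show ?thesis
      using models_guard_cst[OF assms(2) that(1) c that(4,5)] that(6) C by (simp add: \<psi>_def holds_def)
  qed
  obtain T1 :: "struct \<Rightarrow> form set" and F1 Q1 where 1: "finite F1" "\<And>A. A \<in> Str ?\<tau> \<Longrightarrow> T1 A \<in> F1"
    "\<And>A B. A \<in> Str ?\<tau> \<Longrightarrow> B \<in> Str ?\<tau> \<Longrightarrow> models (rich_union A B) (\<psi> (CLeft c)) \<longleftrightarrow> Q1 (T1 A) (T1 B)"
    using finite_types[OF voc(1) \<psi>, of "CLeft c"] by auto metis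
  obtain T2 :: "struct \<Rightarrow> form set" and F2 Q2 where 2: "finite F2" "\<And>A. A \<in> Str ?\<tau> \<Longrightarrow> T2 A \<in> F2"
    "\<And>A B. A \<in> Str ?\<tau> \<Longrightarrow> B \<in> Str ?\<tau> \<Longrightarrow> models (rich_union A B) (\<psi> (CRight c)) \<longleftrightarrow> Q2 (T2 A) (T2 B)"
    using finite_types[OF voc(1) \<psi>, of "CRight c"] by auto metis
  let ?e = "\<lambda>A x. set_csts A [c] [x]"
  \<comment> \<open>In \<open>n1\<close> the argument \<open>z\<close> is the type of
    \<open>B\<close> with its dummy; in \<open>n2\<close> it is the type of \<open>A\<close> with
    its dummy.\<close>
  define n1 where "n1 A z = card {x\<in>univ A. Q1 (T1 (?e A x)) z}" for A z
  define n2 where "n2 z B = card {y\<in>univ B. Q2 z (T2 (?e B y))}" for B z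
  have "separable (Str \<tau>) (\<lambda>A B. smono_val t ^ n1 A (T1 (?e B (d B))))"
    by (rule separable_finite_right[OF 1(1)]) (intro 1(2) Str_set_csts d)
  moreover have "separable (Str \<tau>) (\<lambda>A B. smono_val t ^ n2 (T2 (?e A (d A))) B)"
    by (rule separable_finite_left[OF 2(1)]) (intro 2(2) Str_set_csts d)
  ultimately have "separable (Str \<tau>)
      (\<lambda>A B. smono_val t ^ n1 A (T1 (?e B (d B))) * smono_val t ^ n2 (T2 (?e A (d A))) B)"
    by (rule separable_mult)
  moreover have "mono_val (star \<Phi> (rich_union A B)) (ProdC c \<phi> t) =
      smono_val t ^ n1 A (T1 (?e B (d B))) * smono_val t ^ n2 (T2 (?e A (d A))) B"
    if AB: "A \<in> Str \<tau>" "B \<in> Str \<tau>" "cst_closed \<tau> (star \<Phi> (rich_union A B))" for A B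
  proof -
    let ?M = "star \<Phi> (rich_union A B)"
    let ?X = "{x\<in>univ A. Q1 (T1 (?e A x)) (T1 (?e B (d B)))}"
    let ?Y = "{y\<in>univ B. Q2 (T2 (?e A (d A))) (T2 (?e B y))}"
    have X: "?X = {x\<in>univ A. inl x \<in> univ ?M \<and> models (?e ?M (inl x)) \<phi>}"
      using models_\<psi>[of "CLeft c" A B _ "d B", OF _ AB(1,2) _ d[OF AB(2)] refl AB(3) refl] AB d
      by (auto simp: 1(3)[symmetric] Str_set_csts)
    have Y: "?Y = {y\<in>univ B. inr y \<in> univ ?M \<and> models (?e ?M (inr y)) \<phi>}"
      using models_\<psi>[of "CRight c" A B "d A", OF _ AB(1,2) d[OF AB(1)] _ refl AB(3) refl] AB d
      by (auto simp: 2(3)[symmetric] Str_set_csts)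
    \<comment> \<open>The solutions split by their tags into disjoint images, so the exponents add
      up.\<close>
    have "{a\<in>univ ?M. models (?e ?M a) \<phi>} = inl ` ?X \<union> inr ` ?Y"
      unfolding X Y by (auto simp: univ_star)
    moreover have "card (inl ` ?X \<union> inr ` ?Y) = card ?X + card ?Y"
      using AB by (subst card_Un_disjoint) (auto simp: Str_def card_image inj_inl inj_inr inl_neq_inr)
    ultimately show ?thesis by (simp add: n1_def n2_def power_add)
  qed
  ultimately show ?thesis unfolding star_separable_def by blast
qed

lemma star_separable_mono:
  assumes "vocabulary \<tau>" "transduction L (rich_vocab \<tau>) \<tau> \<Phi>" "is_mono L \<tau> m"
  shows "star_separable \<tau> \<Phi> (\<lambda>M. mono_val M m)"
  using assms(3)
proof (induction m)
  case (Simple t)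
  show ?case unfolding star_separable_def by (intro exI[of _ "\<lambda>A B. smono_val t"]) (simp add: separable_const)
next
  case (ProdC c \<phi> t)
  then show ?case by (rule star_separable_ProdC[OF assms(1,2)])
next
  case (Times m n)
  then obtain h k where hk: "separable (Str \<tau>) h" "separable (Str \<tau>) k"
    "\<And>A B. A \<in> Str \<tau> \<Longrightarrow> B \<in> Str \<tau> \<Longrightarrow> cst_closed \<tau> (star \<Phi> (rich_union A B)) \<Longrightarrow>
      mono_val (star \<Phi> (rich_union A B)) m = h A B \<and> mono_val (star \<Phi> (rich_union A B)) n = k A B"
    unfolding star_separable_def by (auto; metis)
  show ?case
    unfolding star_separable_def using hk by (intro exI[of _ "\<lambda>A B. h A B * k A B"]) (simp add: separable_mult)
qed

text \<open>Each of the two partial sums runs over the expansions of one component, while the other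
  is expanded by its dummy alone. Elements outside the transduced universe contribute
  \<open>0\<close> through the guard.\<close>

lemma star_separable_sum_cst:
  assumes "vocabulary \<tau>" "transduction L (rich_vocab \<tau>) \<tau> \<Phi>" "c \<notin> csts \<tau>" "is_lpoly L (add_csts \<tau> [c]) p"
    and "\<And>b. b \<in> {CLeft c, CRight c} \<Longrightarrow> star_separable (add_csts \<tau> [c]) (transd_cst \<Phi> c b) (\<lambda>M. lpoly_val M p)"
  shows "star_separable \<tau> \<Phi> (\<lambda>M. \<Sum>a\<in>univ M. lpoly_val (set_csts M [c] [a]) p)"
proof -
  let ?\<tau> = "add_csts \<tau> [c]" and ?e = "\<lambda>A x. set_csts A [c] [x]"
  define d where "d A = (SOME a. a \<in> univ A)" for A :: struct
  have d: "d A \<in> univ A" if "A \<in> Str \<tau>" for A using that by (auto simp: d_def Str_def some_in_eq)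
  have voc: "vocabulary ?\<tau>" by (intro vocabulary_add assms)
  \<comment> \<open>Stated for either tag \<open>b\<close>, so that the left and the right sum are
    two instances; \<open>M\<close> and \<open>C\<close> stand for the transduced structure and the
    expanded union.\<close>
  have "\<exists>h. separable (Str ?\<tau>) h \<and> (\<forall>A B x y M C. A \<in> Str \<tau> \<longrightarrow> B \<in> Str \<tau> \<longrightarrow> x \<in> univ A \<longrightarrow> y \<in> univ B \<longrightarrow>
      M = star \<Phi> (rich_union A B) \<longrightarrow> C = rich_union (?e A x) (?e B y) \<longrightarrow> cst_closed \<tau> M \<longrightarrow>
      h (?e A x) (?e B y) = (if cst C b \<in> univ M then lpoly_val (?e M (cst C b)) p else 0))"
    if b: "b \<in> {CLeft c, CRight c}" for b
  proof -
    obtain h where h: "separable (Str ?\<tau>) h" "\<And>A B. A \<in> Str ?\<tau> \<Longrightarrow> B \<in> Str ?\<tau> \<Longrightarrow>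
        cst_closed ?\<tau> (star (transd_cst \<Phi> c b) (rich_union A B)) \<Longrightarrow>
        lpoly_val (star (transd_cst \<Phi> c b) (rich_union A B)) p = h A B"
      using assms(5)[OF b] unfolding star_separable_def by blast
    let ?h = "\<lambda>A B. (if models (rich_union A B) (guard_cst \<Phi> b) then 1 else 0) * h A B"
    have "separable (Str ?\<tau>) ?h"
      by (intro separable_mult separable_indicator h sentence_guard_cst voc assms b)
    moreover have "?h (?e A x) (?e B y) = (if cst C b \<in> univ M then lpoly_val (?e M (cst C b)) p else 0)"
      if "A \<in> Str \<tau>" "B \<in> Str \<tau>" "x \<in> univ A" "y \<in> univ B" "M = star \<Phi> (rich_union A B)"
        "C = rich_union (?e A x) (?e B y)" "cst_closed \<tau> M" for A B x y M C
    proof (cases "cst C b \<in> univ M")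
      case True
      have agr: "agree ?\<tau> (star (transd_cst \<Phi> c b) C) (?e M (cst C b))"
        unfolding that by (rule agree_star_transd_cst[OF assms(2,3)])
      moreover have "cst_closed ?\<tau> (?e M (cst C b))"
        using that(7) True by (rule cst_closed_set_csts)
      ultimately have closed: "cst_closed ?\<tau> (star (transd_cst \<Phi> c b) C)"
        by (simp add: cst_closed_def agree_def)
      have "finite (univ (star (transd_cst \<Phi> c b) C))"
        unfolding that by (rule finite_univ_star[of _ ?\<tau>]) (intro Str_set_csts that)+
      then have "lpoly_val (star (transd_cst \<Phi> c b) C) p = lpoly_val (?e M (cst C b)) p"
        using lpoly_val_agree[OF agr closed] assms(4) by blast
      then show ?thesis
        using True closed models_guard_cst[OF assms(2) b assms(3) that(3,4)] h(2) that
        by (simp add: Str_set_csts)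
    next
      case False
      then show ?thesis
        using models_guard_cst[OF assms(2) b assms(3) that(3,4)] that by simp
    qed
    ultimately show ?thesis by blast
  qed
  note ex = this
  obtain h1 where h1: "separable (Str ?\<tau>) h1" "\<And>A B x y. A \<in> Str \<tau> \<Longrightarrow> B \<in> Str \<tau> \<Longrightarrow> x \<in> univ A \<Longrightarrow> y \<in> univ B \<Longrightarrow>
      cst_closed \<tau> (star \<Phi> (rich_union A B)) \<Longrightarrow> h1 (?e A x) (?e B y) =
        (if inl x \<in> univ (star \<Phi> (rich_union A B)) then lpoly_val (?e (star \<Phi> (rich_union A B)) (inl x)) p else 0)"
    using ex[of "CLeft c"] by auto
  obtain h2 where h2: "separable (Str ?\<tau>) h2" "\<And>A B x y. A \<in> Str \<tau> \<Longrightarrow> B \<in> Str \<tau> \<Longrightarrow> x \<in> univ A \<Longrightarrow> y \<in> univ B \<Longrightarrow>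
      cst_closed \<tau> (star \<Phi> (rich_union A B)) \<Longrightarrow> h2 (?e A x) (?e B y) =
        (if inr y \<in> univ (star \<Phi> (rich_union A B)) then lpoly_val (?e (star \<Phi> (rich_union A B)) (inr y)) p else 0)"
    using ex[of "CRight c"] by auto
  \<comment> \<open>The singleton ranges \<open>{d B}\<close> and \<open>{d A}\<close> bring both
    sums into the shape of \<open>separable_sum_expansions\<close>.\<close>
  have "separable (Str \<tau>) (\<lambda>A B. (\<Sum>x\<in>univ A. \<Sum>y\<in>{d B}. h1 (?e A x) (?e B y)) +
      (\<Sum>x\<in>{d A}. \<Sum>y\<in>univ B. h2 (?e A x) (?e B y)))"
    by (intro separable_add separable_sum_expansions[OF h1(1)] separable_sum_expansions[OF h2(1)] Str_set_csts)
      (auto intro: d)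
  then show ?thesis
    unfolding star_separable_def
    by (intro exI conjI, assumption) (simp add: sum_star_univ[OF _ _ refl] h1(2) h2(2) d)
qed

text \<open>In arity one every tuple lies in a single part, so a relation on the transduced universe
  is given by its traces \<open>V\<close> and \<open>W\<close> on the parts. These range
  independently, and the guard discards the pairs that leave the universe.\<close>

lemma star_separable_sum_rel:
  assumes "vocabulary \<tau>" "transduction L (rich_vocab \<tau>) \<tau> \<Phi>" "R \<notin> rels \<tau>" "arity R \<le> 1"
    and "is_lpoly L (add_rels \<tau> [R]) p"
    and "star_separable (add_rels \<tau> [R]) (transd_rel \<Phi> R) (\<lambda>M. lpoly_val M p)"
  shows "star_separable \<tau> \<Phi> (\<lambda>M. \<Sum>Z\<in>Pow (tuples (univ M) (arity R)). lpoly_val (set_rels M [R] [Z]) p)"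
proof -
  let ?\<tau> = "add_rels \<tau> [R]" and ?e = "\<lambda>A V. set_rels A [R] [V]"
  have voc: "vocabulary ?\<tau>" by (intro vocabulary_add assms)
  obtain h where h: "separable (Str ?\<tau>) h" "\<And>A B. A \<in> Str ?\<tau> \<Longrightarrow> B \<in> Str ?\<tau> \<Longrightarrow>
      cst_closed ?\<tau> (star (transd_rel \<Phi> R) (rich_union A B)) \<Longrightarrow>
      lpoly_val (star (transd_rel \<Phi> R) (rich_union A B)) p = h A B"
    using assms(6) unfolding star_separable_def by blast
  have h_val: "h (?e A V) (?e B W) = lpoly_val (?e (star \<Phi> (rich_union A B)) (map inl ` V \<union> map inr ` W)) p"
    if AB: "A \<in> Str \<tau>" "B \<in> Str \<tau>" and VW: "V \<subseteq> tuples (univ A) (arity R)" "W \<subseteq> tuples (univ B) (arity R)"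
      and closed: "cst_closed \<tau> (star \<Phi> (rich_union A B))"
      and Z: "map inl ` V \<union> map inr ` W \<subseteq> tuples (univ (star \<Phi> (rich_union A B))) (arity R)" for A B V W
  proof -
    let ?N = "star (transd_rel \<Phi> R) (rich_union (?e A V) (?e B W))"
    have agr: "agree ?\<tau> ?N (?e (star \<Phi> (rich_union A B)) (map inl ` V \<union> map inr ` W))"
      by (rule agree_star_transd_rel[OF assms(2,3) Z])
    with cst_closed_set_rels[OF closed] have N: "cst_closed ?\<tau> ?N"
      by (simp add: cst_closed_def agree_def)
    have Str: "?e A V \<in> Str ?\<tau>" "?e B W \<in> Str ?\<tau>" by (intro Str_set_rels AB VW)+
    show ?thesis
      using h(2)[OF Str N] lpoly_val_agree[OF agr N finite_univ_star[OF Str] assms(5)] by simp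
  qed
  consider "arity R = 0" | "arity R = 1" using assms(4) by linarith
  then show ?thesis
  proof cases
    case 1
    \<comment> \<open>A nullary relation is a truth value, which both components share.\<close>
    have "separable (Str \<tau>) (\<lambda>A B. \<Sum>Z\<in>Pow {[]}. \<Sum>V\<in>{Z}. \<Sum>W\<in>{Z}. h (?e A V) (?e B W))"
      by (intro separable_sum separable_sum_expansions[OF h(1)] Str_set_rels) (auto simp: 1)
    moreover have "h (?e A Z) (?e B Z) = lpoly_val (?e (star \<Phi> (rich_union A B)) Z) p"
      if "A \<in> Str \<tau>" "B \<in> Str \<tau>" "cst_closed \<tau> (star \<Phi> (rich_union A B))" "Z \<subseteq> {[]}" for A B Z
    proof -
      have "map inl ` Z \<union> map inr ` Z = Z" using that(4) by auto
      then show ?thesis using h_val[of A B Z Z] that 1 by simp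
    qed
    ultimately show ?thesis
      unfolding star_separable_def by (intro exI[of _ "\<lambda>A B. \<Sum>Z\<in>Pow {[]}. h (?e A Z) (?e B Z)"]) (auto simp: 1)
  next
    case 2
    let ?h = "\<lambda>A B. (if models (rich_union A B) (guard_rel \<Phi> (RIn R)) then 1 else 0) * h A B"
    let ?X = "\<lambda>A. tuples (univ A) (arity R)"
    have "separable (Str ?\<tau>) ?h"
      by (intro separable_mult separable_indicator h sentence_guard_rel voc assms 2)
    then have "separable (Str \<tau>) (\<lambda>A B. \<Sum>V\<in>Pow (?X A). \<Sum>W\<in>Pow (?X B). ?h (?e A V) (?e B W))"
      by (rule separable_sum_expansions) (auto intro: Str_set_rels)
    moreover have "(\<Sum>Z\<in>Pow (?X M). lpoly_val (?e M Z) p) =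
        (\<Sum>V\<in>Pow (?X A). \<Sum>W\<in>Pow (?X B). ?h (?e A V) (?e B W))"
      if AB: "A \<in> Str \<tau>" "B \<in> Str \<tau>" and M: "M = star \<Phi> (rich_union A B)" "cst_closed \<tau> M" for A B M
    proof -
      have eq: "?h (?e A V) (?e B W) = (if map inl ` V \<union> map inr ` W \<subseteq> ?X M
          then lpoly_val (?e M (map inl ` V \<union> map inr ` W)) p else 0)"
        if "V \<in> Pow (?X A)" "W \<in> Pow (?X B)" for V W
        using models_guard_rel[OF assms(2,3) 2, of V A W B] h_val[of A B V W] that AB M by auto
      have split: "(\<Sum>Z\<in>Pow (?X M). lpoly_val (?e M Z) p) =
          (\<Sum>V\<in>Pow (?X A). \<Sum>W\<in>Pow (?X B). if map inl ` V \<union> map inr ` W \<subseteq> ?X M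
            then lpoly_val (?e M (map inl ` V \<union> map inr ` W)) p else 0)"
      proof (rule sum_Pow_split_images)
        show "finite (?X A)" "finite (?X B)" using AB by (auto simp: Str_def finite_tuples)
        \<comment> \<open>This and the covering below rest on length one: in length \<open>0\<close>
          the empty tuple lies in both images, and in length \<open>2\<close> mixed tuples lie in
          neither.\<close>
        show "map inl ` ?X A \<inter> map inr ` ?X B = {}" by (auto simp: 2 tuples_1 inl_neq_inr)
        show "?X M \<subseteq> map inl ` ?X A \<union> map inr ` ?X B" by (auto simp: 2 tuples_1 M univ_star image_image)
      qed (auto simp: 2 tuples_1 inj_on_def sum_encode_eq)
      show ?thesis unfolding split by (intro sum.cong refl) (simp only: eq)
    qed
    ultimately show ?thesis unfolding star_separable_def by blast
  qed
qed

text \<open>The induction generalizes \<open>\<tau>\<close> and \<open>\<Phi>\<close>, since every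
  added symbol enlarges the vocabulary and extends the transduction.\<close>

theorem star_separable_lpoly:
  assumes "vocabulary \<tau>" "transduction L (rich_vocab \<tau>) \<tau> \<Phi>" "is_lpoly L \<tau> P"
  shows "star_separable \<tau> \<Phi> (\<lambda>M. lpoly_val M P)"
  using assms
proof (induction P arbitrary: \<tau> \<Phi> rule: lpoly_symbol_induct)
  case (Mono m)
  then show ?case by (simp add: star_separable_mono)
next
  case (SumC_Nil \<phi> p)
  then show ?case
    unfolding lpoly_val_SumC_Nil by (intro star_separable_indicator) (auto simp: is_lpoly.simps)
next
  case (SumC_Cons c cs \<phi> p)
  note c = is_lpoly_SumC_Cons[OF SumC_Cons.prems(3)]
  have "star_separable \<tau> \<Phi> (\<lambda>M. \<Sum>a\<in>univ M. lpoly_val (set_csts M [c] [a]) (SumC cs \<phi> p))"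
    using c SumC_Cons.prems
    by (intro star_separable_sum_cst SumC_Cons.IH transduction_transd_cst vocabulary_add) auto
  then show ?case
    unfolding star_separable_def using c by (auto simp: lpoly_val_SumC_Cons finite_univ_star)
next
  case (SumR_Nil \<phi> p)
  then show ?case
    unfolding lpoly_val_SumR_Nil by (intro star_separable_indicator) (auto simp: is_lpoly.simps)
next
  case (SumR_Cons R Rs \<phi> p)
  note R = is_lpoly_SumR_Cons[OF SumR_Cons.prems(3)]
  have "star_separable \<tau> \<Phi>
      (\<lambda>M. \<Sum>V\<in>Pow (tuples (univ M) (arity R)). lpoly_val (set_rels M [R] [V]) (SumR Rs \<phi> p))"
    using R SumR_Cons.prems
    by (intro star_separable_sum_rel SumR_Cons.IH transduction_transd_rel vocabulary_add) auto
  then show ?case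
    unfolding star_separable_def using R by (auto simp: lpoly_val_SumR_Cons finite_univ_star)
qed

end

section \<open>The connection matrix of a sum-like operation\<close>

theorem theorem7p6:
  fixes L :: "form set" and qr :: "form \<Rightarrow> nat" and \<tau> :: vocab
    and opn :: "struct \<Rightarrow> struct \<Rightarrow> struct" and P :: "'x::{finite,linorder} lpoly"
  assumes "tame_fragment L qr"
    and "rich_union_smooth L qr"
    and "vocabulary \<tau>"
    and "\<And>A B. A \<in> Str \<tau> \<Longrightarrow> B \<in> Str \<tau> \<Longrightarrow> opn A B \<in> Str \<tau>"
    and "sum_like L \<tau> opn"
    and "is_lpoly L \<tau> P"
  shows "matrix_rank (Str \<tau>) (Str \<tau>) (connection_matrix opn P) < \<infinity>"
proof -
  interpret tame_fragment L qr by (rule assms(1))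
  interpret smooth_fragment L qr by unfold_locales (rule assms(2))
  obtain \<Phi> where \<Phi>: "transduction L (rich_vocab \<tau>) \<tau> \<Phi>"
    and iso: "\<And>A B. A \<in> Str \<tau> \<Longrightarrow> B \<in> Str \<tau> \<Longrightarrow> isomorphic \<tau> (opn A B) (star \<Phi> (rich_union A B))"
    using assms(5) by (auto simp: sum_like_def)
  obtain h where h: "separable (Str \<tau>) h" "\<And>A B. A \<in> Str \<tau> \<Longrightarrow> B \<in> Str \<tau> \<Longrightarrow>
      cst_closed \<tau> (star \<Phi> (rich_union A B)) \<Longrightarrow> lpoly_val (star \<Phi> (rich_union A B)) P = h A B"
    using star_separable_lpoly[OF assms(3) \<Phi> assms(6)] unfolding star_separable_def by blast
  have "separable (Str \<tau>) (\<lambda>A B. lpoly_val (opn A B) P)"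
  proof (rule separable_cong[OF h(1)])
    fix A B assume AB: "A \<in> Str \<tau>" "B \<in> Str \<tau>"
    let ?M = "star \<Phi> (rich_union A B)"
    obtain f where f: "iso_by \<tau> f (opn A B) ?M"
      using iso[OF AB] by (auto simp: isomorphic_def iso_by_def)
    have opn: "cst_closed \<tau> (opn A B)" "finite (univ (opn A B))"
      using assms(4)[OF AB] by (auto simp: Str_def cst_closed_def)
    \<comment> \<open>The constants of \<open>opn A B\<close> lie in its universe, and
      \<open>f\<close> carries this over to \<open>?M\<close>, where \<open>h\<close> is then known
      to give the value.\<close>
    have "f ` univ (opn A B) = univ ?M" "\<forall>c\<in>csts \<tau>. f (cst (opn A B) c) = cst ?M c"
      using f by (auto simp: iso_by_def bij_betw_def)
    then have "cst_closed \<tau> ?M" using opn(1) by (metis cst_closed_def imageI)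
    then show "lpoly_val (opn A B) P = h A B"
      using h(2)[OF AB] lpoly_val_iso[OF f opn assms(6)] by simp
  qed
  then show ?thesis
    unfolding connection_matrix_def by (rule matrix_rank_separable)
qed

end
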